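(* Let $E\subset\mathbb{C}$ be a polynomially convex, regular, compact set and for each $n\in\{1,2,\dots\}$ let $\zeta^{(n)}=\{\zeta_0^{(n)},\dots,\zeta_n^{(n)}\}$ be an $(n+1)$-tuple of distinct points in $E$. Then the following two conditions are equivalent: (1) $\displaystyle\lim_{n\to\infty}\Lambda_n(E,\zeta^{(n)})^{1/n}=1$; (2) $\displaystyle\lim_{n\to\infty}\ \min_{k\in\{0,\dots,n\}}\Big|\prod_{j\in\{0,\dots,n\}\setminus\{k\}}\big(\zeta_j^{(n)}-\zeta_k^{(n)}\big)\Big|^{1/n}=\mathrm{cap}\,E$.
   Context: For compact $E\subset\mathbb{C}$, the polynomially convex hull is $\widehat E=\{z\in\mathbb{C}:|p(z)|\le\max_{w\in E}|p(w)|\text{ for every complex polynomial }p\}$; $E$ is polynomially convex if $E=\widehat E$. A compact set $E$ is regular if the Green function of $D_\infty=\mathbb{C}\setminus\widehat E$ with pole at infinity exists, i.e. there is a function $g_E:D_\infty\to\mathbb{R}$, harmonic and positive in $D_\infty$, with $g_E(z)\to0$ as $z\to\partial D_\infty$ and $g_E(z)-\log|z|\to\gamma\in\mathbb{R}$ as $z\to\infty$. Then the logarithmic capacity is $\mathrm{cap}\,E=e^{-\gamma}$. For a tuple $\zeta^{(n)}$ of $n+1$ distinct points of $E$, the fundamental Lagrange interpolation polynomials are $L^{(j)}(z,\zeta^{(n)})=\prod_{k\in\{0,\dots,n\}\setminus\{j\}}\frac{z-\zeta_k^{(n)}}{\zeta_j^{(n)}-\zeta_k^{(n)}}$, $j=0,\dots,n$,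 and the $n$-th Lebesgue constant is $\Lambda_n(E,\zeta^{(n)})=\max_{z\in E}\sum_{j=0}^n|L^{(j)}(z,\zeta^{(n)})|$. *)

theory Defs
  imports "HOL-Analysis.Analysis" "HOL-Computational_Algebra.Polynomial"
begin

definition poly_convex_hull :: "complex set \<Rightarrow> complex set" where
  "poly_convex_hull E =
     {z. \<forall>p :: complex poly. norm (poly p z) \<le> (SUP w\<in>E. norm (poly p w))}"

definition polynomially_convex :: "complex set \<Rightarrow> bool" where
  "polynomially_convex E \<longleftrightarrow> E = poly_convex_hull E"

text \<open>
  Twice continuously differentiable solutions of the Laplace equation on an open set;
  \<open>ux\<close>, \<open>uy\<close> are the first and \<open>uxx\<close>, \<open>uxy\<close>, \<open>uyx\<close>, \<open>uyy\<close> the second partial derivatives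
  with respect to the real coordinates \<open>x = Re z\<close> and \<open>y = Im z\<close>.
\<close>

definition harmonic_on :: "(complex \<Rightarrow> real) \<Rightarrow> complex set \<Rightarrow> bool" where
  "harmonic_on u D \<longleftrightarrow> open D \<and>
     (\<exists>ux uy uxx uxy uyx uyy :: complex \<Rightarrow> real.
        continuous_on D uxx \<and> continuous_on D uxy \<and>
        continuous_on D uyx \<and> continuous_on D uyy \<and>
        (\<forall>z\<in>D.
           (u has_derivative (\<lambda>h. ux z * Re h + uy z * Im h)) (at z) \<and>
           (ux has_derivative (\<lambda>h. uxx z * Re h + uxy z * Im h)) (at z) \<and>
           (uy has_derivative (\<lambda>h. uyx z * Re h + uyy z * Im h)) (at z) \<and>
           uxx z + uyy z = 0))"

definition outer_domain :: "complex set \<Rightarrow> complex set" where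
  "outer_domain E = - poly_convex_hull E"

text \<open>
  \<open>g\<close> is a Green function of the outer domain with pole at infinity, and \<open>\<gamma>\<close> is its
  limit value after removing the logarithmic pole. The values of \<open>g\<close> off the outer domain are
  irrelevant.
\<close>

definition green_function :: "complex set \<Rightarrow> (complex \<Rightarrow> real) \<Rightarrow> real \<Rightarrow> bool" where
  "green_function E g \<gamma> \<longleftrightarrow>
     harmonic_on g (outer_domain E) \<and>
     (\<forall>z\<in>outer_domain E. g z > 0) \<and>
     (\<forall>\<xi>\<in>frontier (outer_domain E). (g \<longlongrightarrow> 0) (at \<xi> within outer_domain E)) \<and>
     ((\<lambda>z. g z - ln (norm z)) \<longlongrightarrow> \<gamma>) at_infinity"

definition regular_compact :: "complex set \<Rightarrow> bool" where
  "regular_compact E \<longleftrightarrow> compact E \<and> (\<exists>g \<gamma>. green_function E g \<gamma>)"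

text \<open>
  The Green function of a regular compact set is unique on the outer domain by the maximum
  principle, so \<open>\<gamma>\<close> is determined by \<open>E\<close>. The value is unspecified if \<open>E\<close> is not regular.
\<close>

definition log_capacity :: "complex set \<Rightarrow> real" where
  "log_capacity E = exp (- (THE \<gamma>. \<exists>g. green_function E g \<gamma>))"

text \<open>
  A tuple \<open>(\<zeta>\<^sub>0, \<dots>, \<zeta>\<^sub>n)\<close> is a sequence of which only the entries with index at
  most \<open>n\<close> are used.
\<close>

definition lagrange_fund :: "nat \<Rightarrow> (nat \<Rightarrow> complex) \<Rightarrow> nat \<Rightarrow> complex \<Rightarrow> complex" where
  "lagrange_fund n \<zeta> j z = (\<Prod>k\<in>{0..n} - {j}. (z - \<zeta> k) / (\<zeta> j - \<zeta> k))"

definition lebesgue_const :: "complex set \<Rightarrow> nat \<Rightarrow> (nat \<Rightarrow> complex) \<Rightarrow> real" where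
  "lebesgue_const E n \<zeta> = (SUP z\<in>E. \<Sum>j=0..n. norm (lagrange_fund n \<zeta> j z))"

end

theory Submission
  imports Defs "HOL-Complex_Analysis.Complex_Analysis" "HOL-Real_Asymp.Real_Asymp"
begin

text \<open>
  Let \<open>D\<close> be the complement of \<open>E\<close>, \<open>g\<close> its Green function, \<open>\<omega>(z) = \<Prod>\<^sub>j (z - \<zeta>\<^sub>j)\<close> the node
  polynomial and \<open>m\<close> the minimum over \<open>k\<close> of \<open>\<bar>\<omega>'(\<zeta>\<^sub>k)\<bar>\<close>, called the gap. The Lagrange polynomials
  are \<open>L\<^sub>k(z) = \<omega>(z) / ((z - \<zeta>\<^sub>k) \<omega>'(\<zeta>\<^sub>k))\<close>, and the capacity is \<open>exp (- \<gamma>)\<close>, where \<open>\<gamma>\<close> is the limit of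
  \<open>g(z) - ln \<bar>z\<bar>\<close>. Everything rests on three comparisons with \<open>g\<close> in \<open>D\<close>.

  First, the sum of the \<open>L\<^sub>k\<close> is \<open>1\<close>, so \<open>\<bar>\<omega>(z)\<bar>\<close> is at least \<open>m dist(z, E) / (n + 1)\<close>
  (\<open>pot_lower\<close>). Let \<open>u = ln \<bar>\<omega>\<bar> / (n + 1)\<close>. The function \<open>u - g\<close> is harmonic in \<open>D\<close> and has the limit
  \<open>- \<gamma>\<close> at infinity, and \<open>g\<close> is small near \<open>E\<close>. The minimum principle then gives
  \<open>u - g \<ge> (ln m) / (n + 1) - o(1)\<close> on compact subsets of \<open>D\<close> and at infinity (\<open>pot_minus_g_lower\<close>). The value at
  infinity shows that \<open>m\<close> to the power \<open>1/n\<close> is asymptotically at most the capacity, for all choices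
  of nodes. This is the inequality between transfinite diameter and capacity, in the form required here.

  Second, each \<open>L\<^sub>k\<close> is bounded by the Lebesgue constant \<open>\<Lambda>\<close> on \<open>E\<close>, has all its zeros in \<open>E\<close> and leading
  coefficient of absolute value \<open>1 / \<bar>\<omega>'(\<zeta>\<^sub>k)\<bar>\<close>. The minimum principle for \<open>g - ln \<bar>L\<^sub>k\<bar> / n\<close> yields
  \<open>exp (- \<gamma>) ^ n \<le> \<Lambda> m\<close> (\<open>power_capacity_le\<close>). So if the roots of the Lebesgue constants tend to
  \<open>1\<close>, the roots of the gaps tend to the capacity.

  Third, suppose that the roots of the gaps tend to the capacity. Then \<open>v = u - g + \<gamma>\<close> is harmonic in
  \<open>D\<close>, vanishes at infinity, and is at least \<open>- o(1)\<close> on compact subsets of \<open>D\<close>. As \<open>D\<close> is connected,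
  Harnack's inequality makes \<open>v\<close> at most \<open>o(1)\<close> on compact sets as well
  (\<open>harnack_vanishing_at_infinity\<close>). On the set at a small fixed distance \<open>\<eta>\<close> from \<open>E\<close> this bounds
  \<open>\<bar>\<omega>\<bar>\<close>, hence all \<open>L\<^sub>k\<close>, and by the maximum modulus principle it bounds \<open>\<Lambda>\<close>
  (\<open>lebesgue_const_upper\<close>).

  Harmonic functions are handled through their holomorphic gradient \<open>u\<^sub>x - \<i> u\<^sub>y\<close>, so that Harnack's
  inequality on discs follows from the Schwarz lemma, and the minimum principle from Harnack's
  inequality. The point at infinity is treated by adding small multiples of \<open>g\<close>.
\<close>

section \<open>Harmonic functions and holomorphic gradients\<close>

text \<open>
  The mixed second difference of \<open>u\<close> is symmetric in the two directions, and two applications of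
  the mean value theorem express it by either mixed second derivative. This yields the symmetry of
  the second partial derivatives.
\<close>

lemma mixed_second_difference:
  fixes u p q :: "complex \<Rightarrow> real" and a b z :: complex and t :: real
  assumes t: "t > 0" and ab: "norm a = 1" "norm b = 1"
    and u: "\<And>w. w \<in> cball z (2 * t) \<Longrightarrow> \<exists>U. (u has_derivative U) (at w) \<and> U a = p w"
    and p: "\<And>w. w \<in> cball z (2 * t) \<Longrightarrow> \<exists>P. (p has_derivative P) (at w) \<and> P b = q w"
  shows "\<exists>\<xi>\<in>cball z (2 * t).
    u (z + t *\<^sub>R a + t *\<^sub>R b) - u (z + t *\<^sub>R a) - u (z + t *\<^sub>R b) + u z = t * (t * q \<xi>)"
proof -
  have inside: "z + s *\<^sub>R a + r *\<^sub>R b \<in> cball z (2 * t)" 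
    if "0 \<le> s" "s \<le> t" "0 \<le> r" "r \<le> t" for s r
  proof -
    have "dist z (z + s *\<^sub>R a + r *\<^sub>R b) = norm (s *\<^sub>R a + r *\<^sub>R b)"
      by (metis add.assoc dist_0_norm dist_add_cancel add.right_neutral)
    also have "\<dots> \<le> s + r"
      using norm_triangle_ineq[of "s *\<^sub>R a" "r *\<^sub>R b"] that ab by simp
    finally show ?thesis using that by simp
  qed
  have along: "((\<lambda>s. v (w0 + s *\<^sub>R d)) has_real_derivative V d) (at s)"
    if "(v has_derivative V) (at (w0 + s *\<^sub>R d))" for v :: "complex \<Rightarrow> real" and V w0 d s
  proof -
    have "((\<lambda>s. v (w0 + s *\<^sub>R d)) has_derivative (\<lambda>h. V (h *\<^sub>R d))) (at s)"
    proof (rule has_derivative_compose[of "\<lambda>s. w0 + s *\<^sub>R d" "\<lambda>h. h *\<^sub>R d" s UNIV v V])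
      show "((\<lambda>s. w0 + s *\<^sub>R d) has_derivative (\<lambda>h. h *\<^sub>R d)) (at s)"
        by (auto intro!: derivative_eq_intros)
    qed (rule that)
    moreover have "V (h *\<^sub>R d) = V d * h" for h
      using linear_scale[OF has_derivative_linear[OF that]] by simp
    ultimately show ?thesis by (simp add: has_field_derivative_def)
  qed
  have "\<exists>s. 0 < s \<and> s < t \<and>
     (u (z + t *\<^sub>R b + t *\<^sub>R a) - u (z + t *\<^sub>R a)) - (u (z + t *\<^sub>R b + 0 *\<^sub>R a) - u (z + 0 *\<^sub>R a))
       = (t - 0) * (p (z + t *\<^sub>R b + s *\<^sub>R a) - p (z + s *\<^sub>R a))"
  proof (rule MVT2[OF t])
    fix s assume s: "0 \<le> s" "s \<le> t"
    have 1: "z + t *\<^sub>R b + s *\<^sub>R a \<in> cball z (2 * t)" using inside[of s t] s t by (simp add: add_ac)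
    have 2: "z + s *\<^sub>R a \<in> cball z (2 * t)" using inside[of s 0] s t by simp
    obtain U1 U2 where U: "(u has_derivative U1) (at (z + t *\<^sub>R b + s *\<^sub>R a))" "U1 a = p (z + t *\<^sub>R b + s *\<^sub>R a)"
      "(u has_derivative U2) (at (z + s *\<^sub>R a))" "U2 a = p (z + s *\<^sub>R a)"
      using u[OF 1] u[OF 2] by blast
    show "((\<lambda>s. u (z + t *\<^sub>R b + s *\<^sub>R a) - u (z + s *\<^sub>R a)) has_real_derivative
          p (z + t *\<^sub>R b + s *\<^sub>R a) - p (z + s *\<^sub>R a)) (at s)"
      using DERIV_diff[OF along[OF U(1)] along[OF U(3)]] U by simp
  qed
  then obtain s where s: "0 < s" "s < t" and
    s_eq: "(u (z + t *\<^sub>R b + t *\<^sub>R a) - u (z + t *\<^sub>R a)) - (u (z + t *\<^sub>R b) - u z)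
       = t * (p (z + s *\<^sub>R a + t *\<^sub>R b) - p (z + s *\<^sub>R a))"
    by (auto simp: add_ac)
  have "\<exists>r. 0 < r \<and> r < t \<and>
     p (z + s *\<^sub>R a + t *\<^sub>R b) - p (z + s *\<^sub>R a + 0 *\<^sub>R b) = (t - 0) * q (z + s *\<^sub>R a + r *\<^sub>R b)"
  proof (rule MVT2[OF t])
    fix r assume r: "0 \<le> r" "r \<le> t"
    obtain P where P: "(p has_derivative P) (at (z + s *\<^sub>R a + r *\<^sub>R b))" "P b = q (z + s *\<^sub>R a + r *\<^sub>R b)"
      using p[OF inside[of s r]] r s by auto
    show "((\<lambda>r. p (z + s *\<^sub>R a + r *\<^sub>R b)) has_real_derivative q (z + s *\<^sub>R a + r *\<^sub>R b)) (at r)"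
      using along[OF P(1)] P(2) by simp
  qed
  then obtain r where r: "0 < r" "r < t" and
    r_eq: "p (z + s *\<^sub>R a + t *\<^sub>R b) - p (z + s *\<^sub>R a) = t * q (z + s *\<^sub>R a + r *\<^sub>R b)" by auto
  show ?thesis
  proof (rule bexI)
    show "z + s *\<^sub>R a + r *\<^sub>R b \<in> cball z (2 * t)" using inside s r by simp
    show "u (z + t *\<^sub>R a + t *\<^sub>R b) - u (z + t *\<^sub>R a) - u (z + t *\<^sub>R b) + u z =
          t * (t * q (z + s *\<^sub>R a + r *\<^sub>R b))"
      using s_eq r_eq by (simp add: algebra_simps)
  qed
qed

lemma mixed_partials_eq:
  fixes u ux uy uxx uxy uyx uyy :: "complex \<Rightarrow> real"
  assumes D: "open D" "z \<in> D"
    and cont: "continuous_on D uxy" "continuous_on D uyx"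
    and u: "\<And>w. w \<in> D \<Longrightarrow> (u has_derivative (\<lambda>h. ux w * Re h + uy w * Im h)) (at w)"
    and ux: "\<And>w. w \<in> D \<Longrightarrow> (ux has_derivative (\<lambda>h. uxx w * Re h + uxy w * Im h)) (at w)"
    and uy: "\<And>w. w \<in> D \<Longrightarrow> (uy has_derivative (\<lambda>h. uyx w * Re h + uyy w * Im h)) (at w)"
  shows "uxy z = uyx z"
proof -
  have "\<bar>uxy z - uyx z\<bar> < e" if e: "e > 0" for e
  proof -
    have "isCont uxy z" "isCont uyx z"
      using cont D by (auto simp: continuous_on_eq_continuous_at)
    then have "\<forall>\<^sub>F w in nhds z. dist (uxy w) (uxy z) < e/2" 
              "\<forall>\<^sub>F w in nhds z. dist (uyx w) (uyx z) < e/2"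
      using e by (auto simp: continuous_at_eps_delta eventually_nhds_metric dist_norm 
            dest!: spec[of _ "e/2"])
    moreover have "\<forall>\<^sub>F w in nhds z. w \<in> D" using D by (rule eventually_nhds_in_open)
    ultimately have "\<forall>\<^sub>F w in nhds z. dist (uxy w) (uxy z) < e/2 \<and> dist (uyx w) (uyx z) < e/2 \<and> w \<in> D"
      by eventually_elim auto
    then obtain d where d: "d > 0" and
      near: "\<And>w. dist w z < d \<Longrightarrow> dist (uxy w) (uxy z) < e/2 \<and> dist (uyx w) (uyx z) < e/2 \<and> w \<in> D"
      unfolding eventually_nhds_metric by blast
    define t where "t = d / 4"
    have t: "t > 0" and sub: "\<And>w. w \<in> cball z (2 * t) \<Longrightarrow> dist w z < d"
      using d by (auto simp: t_def dist_commute)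
    have in_D: "w \<in> D" if "w \<in> cball z (2 * t)" for w
      using near[OF sub[OF that]] by blast
    have "\<exists>\<xi>\<in>cball z (2 * t).
      u (z + t *\<^sub>R 1 + t *\<^sub>R \<i>) - u (z + t *\<^sub>R 1) - u (z + t *\<^sub>R \<i>) + u z = t * (t * uxy \<xi>)"
    proof (rule mixed_second_difference[OF t])
      show "\<exists>U. (u has_derivative U) (at w) \<and> U 1 = ux w" if "w \<in> cball z (2 * t)" for w
        using u[OF in_D[OF that]] by (intro exI[of _ "\<lambda>h. ux w * Re h + uy w * Im h"]) simp
      show "\<exists>P. (ux has_derivative P) (at w) \<and> P \<i> = uxy w" if "w \<in> cball z (2 * t)" for w
        using ux[OF in_D[OF that]] by (intro exI[of _ "\<lambda>h. uxx w * Re h + uxy w * Im h"]) simp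
    qed simp_all
    then obtain \<xi> where \<xi>: "\<xi> \<in> cball z (2 * t)"
      "u (z + t *\<^sub>R 1 + t *\<^sub>R \<i>) - u (z + t *\<^sub>R 1) - u (z + t *\<^sub>R \<i>) + u z = t * (t * uxy \<xi>)"
      by blast
    have "\<exists>\<xi>\<in>cball z (2 * t).
      u (z + t *\<^sub>R \<i> + t *\<^sub>R 1) - u (z + t *\<^sub>R \<i>) - u (z + t *\<^sub>R 1) + u z = t * (t * uyx \<xi>)"
    proof (rule mixed_second_difference[OF t])
      show "\<exists>U. (u has_derivative U) (at w) \<and> U \<i> = uy w" if "w \<in> cball z (2 * t)" for w
        using u[OF in_D[OF that]] by (intro exI[of _ "\<lambda>h. ux w * Re h + uy w * Im h"]) simp
      show "\<exists>P. (uy has_derivative P) (at w) \<and> P 1 = uyx w" if "w \<in> cball z (2 * t)" for w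
        using uy[OF in_D[OF that]] by (intro exI[of _ "\<lambda>h. uyx w * Re h + uyy w * Im h"]) simp
    qed simp_all
    then obtain \<eta> where \<eta>: "\<eta> \<in> cball z (2 * t)"
      "u (z + t *\<^sub>R \<i> + t *\<^sub>R 1) - u (z + t *\<^sub>R \<i>) - u (z + t *\<^sub>R 1) + u z = t * (t * uyx \<eta>)"
      by blast
    have "t * (t * uxy \<xi>) = t * (t * uyx \<eta>)"
    proof -
      have "z + t *\<^sub>R 1 + t *\<^sub>R \<i> = z + t *\<^sub>R \<i> + t *\<^sub>R 1" by simp
      then have "u (z + t *\<^sub>R 1 + t *\<^sub>R \<i>) = u (z + t *\<^sub>R \<i> + t *\<^sub>R 1)" by (rule arg_cong)
      then show ?thesis using \<xi>(2) \<eta>(2) by linarith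
    qed
    then have "uxy \<xi> = uyx \<eta>" using t by simp
    moreover have "dist (uxy \<xi>) (uxy z) < e/2" "dist (uyx \<eta>) (uyx z) < e/2"
      using \<xi>(1) \<eta>(1) sub near by auto
    ultimately show ?thesis unfolding dist_real_def by linarith
  qed
  then have "\<not> \<bar>uxy z - uyx z\<bar> > 0" by blast
  then show ?thesis by simp
qed

text \<open>
  The function \<open>u\<^sub>x - \<i> u\<^sub>y\<close> satisfies the Cauchy-Riemann equations: one of them is the Laplace
  equation, the other the symmetry of the mixed partial derivatives. With this description, harmonicity of
  sums, multiples and \<open>ln \<bar>z - a\<bar>\<close> reduces to holomorphy of the gradients.
\<close>

lemma harmonic_on_iff_holomorphic_gradient:
  "harmonic_on u D \<longleftrightarrow> open D \<and>
     (\<exists>f. f holomorphic_on D \<and> (\<forall>z\<in>D. (u has_derivative (\<lambda>h. Re (f z * h))) (at z)))"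
    (is "?L \<longleftrightarrow> ?R")
proof
  assume ?L
  then obtain ux uy uxx uxy uyx uyy where D: "open D" and
    cont: "continuous_on D uxy" "continuous_on D uyx" and
    u: "\<And>z. z \<in> D \<Longrightarrow> (u has_derivative (\<lambda>h. ux z * Re h + uy z * Im h)) (at z)" and
    ux: "\<And>z. z \<in> D \<Longrightarrow> (ux has_derivative (\<lambda>h. uxx z * Re h + uxy z * Im h)) (at z)" and
    uy: "\<And>z. z \<in> D \<Longrightarrow> (uy has_derivative (\<lambda>h. uyx z * Re h + uyy z * Im h)) (at z)" and
    lap: "\<And>z. z \<in> D \<Longrightarrow> uxx z + uyy z = 0"
    unfolding harmonic_on_def by blast
  define f where "f = (\<lambda>z. of_real (ux z) - \<i> * of_real (uy z))"
  have "(f has_field_derivative (of_real (uxx z) - \<i> * of_real (uxy z))) (at z)" if z: "z \<in> D" for z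
  proof -
    have "(f has_derivative (\<lambda>h. of_real (uxx z * Re h + uxy z * Im h) 
             - \<i> * of_real (uyx z * Re h + uyy z * Im h))) (at z)"
      unfolding f_def
      by (intro has_derivative_diff has_derivative_mult_right has_derivative_of_real ux uy z)
    moreover have "of_real (uxx z * Re h + uxy z * Im h) - \<i> * of_real (uyx z * Re h + uyy z * Im h)
        = (of_real (uxx z) - \<i> * of_real (uxy z)) * h" for h
    proof -
      have "uyx z = uxy z" 
        by (rule mixed_partials_eq[where u = u and ux = ux and uy = uy and uxx = uxx and uyy = uyy,
              OF D z cont u ux uy, symmetric])
      moreover have "uyy z = - uxx z" using lap[OF z] by simp
      ultimately show ?thesis by (simp add: complex_eq_iff algebra_simps)
    qed
    ultimately show ?thesis by (simp add: has_field_derivative_def)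
  qed
  then have "f holomorphic_on D" using D by (auto simp: holomorphic_on_open)
  moreover have "(u has_derivative (\<lambda>h. Re (f z * h))) (at z)" if "z \<in> D" for z
    using u[OF that] by (simp add: f_def)
  ultimately show ?R by (intro conjI exI[of _ f] ballI D)
next
  assume ?R
  then obtain f where D: "open D" and f: "f holomorphic_on D" and
    u: "\<And>z. z \<in> D \<Longrightarrow> (u has_derivative (\<lambda>h. Re (f z * h))) (at z)" by blast
  have f': "(f has_derivative (\<lambda>h. deriv f z * h)) (at z)" if "z \<in> D" for z
    using holomorphic_derivI[OF f D that] by (simp add: has_field_derivative_def)
  have hol: "deriv f holomorphic_on D" using f D by (rule holomorphic_deriv)
  have re: "((\<lambda>z. Re (f z)) has_derivative (\<lambda>h. Re (deriv f z) * Re h + - Im (deriv f z) * Im h)) (at z)"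
    if "z \<in> D" for z
    using has_derivative_Re[OF f'[OF that]] by simp
  have im: "((\<lambda>z. - Im (f z)) has_derivative (\<lambda>h. - Im (deriv f z) * Re h + - Re (deriv f z) * Im h)) (at z)"
    if "z \<in> D" for z
    using has_derivative_minus[OF has_derivative_Im[OF f'[OF that]]] by (simp add: algebra_simps)
  note cont = holomorphic_on_imp_continuous_on[OF hol]
  have du: "(u has_derivative (\<lambda>h. Re (f z) * Re h + - Im (f z) * Im h)) (at z)" if "z \<in> D" for z
    using u[OF that] by simp
  show ?L
    unfolding harmonic_on_def
    by (rule conjI[OF D], rule exI[of _ "\<lambda>z. Re (f z)"], rule exI[of _ "\<lambda>z. - Im (f z)"],
       rule exI[of _ "\<lambda>z. Re (deriv f z)"], rule exI[of _ "\<lambda>z. - Im (deriv f z)"],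
       rule exI[of _ "\<lambda>z. - Im (deriv f z)"], rule exI[of _ "\<lambda>z. - Re (deriv f z)"])
      (intro conjI ballI du re im continuous_intros cont, simp_all)
qed

lemma harmonic_on_imp_open: "harmonic_on u D \<Longrightarrow> open D"
  by (simp add: harmonic_on_def)

lemma harmonic_onI:
  assumes "open D" "f holomorphic_on D"
    "\<And>z. z \<in> D \<Longrightarrow> (u has_derivative (\<lambda>h. Re (f z * h))) (at z)"
  shows "harmonic_on u D"
  unfolding harmonic_on_iff_holomorphic_gradient
  by (intro conjI exI[of _ f] ballI assms)

lemma harmonic_on_imp_continuous_on:
  assumes "harmonic_on u D" shows "continuous_on D u"
proof -
  obtain f where "\<And>z. z \<in> D \<Longrightarrow> (u has_derivative (\<lambda>h. Re (f z * h))) (at z)"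
    using assms unfolding harmonic_on_iff_holomorphic_gradient by blast
  from has_derivative_continuous[OF this] have "isCont u z" if "z \<in> D" for z using that .
  then show ?thesis by (simp add: continuous_at_imp_continuous_on)
qed

lemma harmonic_on_subset:
  assumes "harmonic_on u D" "open D'" "D' \<subseteq> D" shows "harmonic_on u D'"
proof -
  obtain f where f: "f holomorphic_on D"
     "\<And>z. z \<in> D \<Longrightarrow> (u has_derivative (\<lambda>h. Re (f z * h))) (at z)"
    using assms(1) unfolding harmonic_on_iff_holomorphic_gradient by blast
  show ?thesis
  proof (rule harmonic_onI)
    show "f holomorphic_on D'" using f(1) assms(3) by (rule holomorphic_on_subset)
    show "(u has_derivative (\<lambda>h. Re (f z * h))) (at z)" if "z \<in> D'" for z
      by (rule f(2)) (use assms(3) that in blast)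
  qed (rule assms(2))
qed

lemma harmonic_on_const: "open D \<Longrightarrow> harmonic_on (\<lambda>z. c) D"
  by (rule harmonic_onI[of D "\<lambda>z. 0"]) simp_all

lemma harmonic_on_add:
  assumes "harmonic_on u D" "harmonic_on v D" shows "harmonic_on (\<lambda>z. u z + v z) D"
proof -
  obtain f where f: "f holomorphic_on D" 
     "\<And>z. z \<in> D \<Longrightarrow> (u has_derivative (\<lambda>h. Re (f z * h))) (at z)"
    using assms(1) unfolding harmonic_on_iff_holomorphic_gradient by blast
  obtain g where g: "g holomorphic_on D"
     "\<And>z. z \<in> D \<Longrightarrow> (v has_derivative (\<lambda>h. Re (g z * h))) (at z)"
    using assms(2) unfolding harmonic_on_iff_holomorphic_gradient by blast
  show ?thesis
  proof (rule harmonic_onI)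
    show "(\<lambda>z. f z + g z) holomorphic_on D" by (intro holomorphic_intros f(1) g(1))
    show "((\<lambda>z. u z + v z) has_derivative (\<lambda>h. Re ((f z + g z) * h))) (at z)" if "z \<in> D" for z
      using has_derivative_add[OF f(2) g(2)] that by (simp add: algebra_simps)
  qed (rule harmonic_on_imp_open[OF assms(1)])
qed

lemma harmonic_on_cmult:
  assumes "harmonic_on u D" shows "harmonic_on (\<lambda>z. c * u z) D"
proof -
  obtain f where f: "f holomorphic_on D" 
     "\<And>z. z \<in> D \<Longrightarrow> (u has_derivative (\<lambda>h. Re (f z * h))) (at z)"
    using assms(1) unfolding harmonic_on_iff_holomorphic_gradient by blast
  show ?thesis
  proof (rule harmonic_onI)
    show "(\<lambda>z. of_real c * f z) holomorphic_on D" by (intro holomorphic_intros f(1))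
    show "((\<lambda>z. c * u z) has_derivative (\<lambda>h. Re (of_real c * f z * h))) (at z)" if "z \<in> D" for z
      using has_derivative_mult_right[OF f(2)[OF that], of c] by (simp add: algebra_simps)
  qed (rule harmonic_on_imp_open[OF assms(1)])
qed

lemma harmonic_on_diff:
  assumes "harmonic_on u D" "harmonic_on v D" shows "harmonic_on (\<lambda>z. u z - v z) D"
  using harmonic_on_add[OF assms(1) harmonic_on_cmult[OF assms(2), of "-1"]] by simp

lemma harmonic_on_sum:
  assumes "open D" "\<And>i. i \<in> I \<Longrightarrow> harmonic_on (u i) D"
  shows "harmonic_on (\<lambda>z. \<Sum>i\<in>I. u i z) D"
  using assms(2)
proof (induction I rule: infinite_finite_induct)
  case (insert i I)
  then show ?case using harmonic_on_add[of "u i" D] by simp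
qed (simp_all add: harmonic_on_const[OF assms(1)])

lemma harmonic_on_ln_norm_diff:
  assumes "open D" "a \<notin> D" shows "harmonic_on (\<lambda>z. ln (norm (z - a))) D"
  unfolding harmonic_on_iff_holomorphic_gradient
proof (intro conjI exI ballI assms(1))
  show "(\<lambda>z. 1 / (z - a)) holomorphic_on D"
    using assms(2) by (auto intro!: holomorphic_intros)
  fix z assume "z \<in> D"
  then have nz: "z - a \<noteq> 0" using assms(2) by auto
  let ?w = "z - a"
  have *: "((\<lambda>z. ln (norm (z - a))) has_derivative (\<lambda>h. inverse (norm ?w) * (h \<bullet> sgn ?w))) (at z)"
  proof -
    have "((\<lambda>z. z - a) has_derivative (\<lambda>h. h)) (at z)" by (auto intro!: derivative_eq_intros)
    from has_derivative_compose[OF this has_derivative_norm[OF nz]]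
    have n: "((\<lambda>z. norm (z - a)) has_derivative (\<lambda>h. h \<bullet> sgn ?w)) (at z)"
      by (simp add: inner_commute)
    show ?thesis using has_derivative_ln[OF _ n] nz by (simp add: mult.commute)
  qed
  moreover have "inverse (norm ?w) * (h \<bullet> sgn ?w) = Re (1 / ?w * h)" for h
  proof -
    have "inverse (norm ?w) * (h \<bullet> sgn ?w) = (h \<bullet> ?w) / (norm ?w)^2"
      unfolding sgn_div_norm inner_scaleR_right by (simp add: power2_eq_square divide_inverse)
    also have "\<dots> = Re (1 / ?w * h)"
      unfolding inner_complex_def cmod_power2 by (simp add: Re_divide algebra_simps)
    finally show ?thesis .
  qed
  ultimately show "((\<lambda>z. ln (norm (z - a))) has_derivative (\<lambda>h. Re (1 / (z - a) * h))) (at z)"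
    by simp
qed

section \<open>Harnack's inequality on discs and the minimum principle\<close>

text \<open>
  The Schwarz lemma applies to \<open>(F - a) / (F + a)\<close>, because \<open>w \<mapsto> (w - a) / (w + a)\<close> maps the
  right half plane into the unit disc and sends \<open>a\<close> to \<open>0\<close>. On the half disc it gives
  \<open>2 \<bar>F - a\<bar> \<le> \<bar>F + a\<bar>\<close>, a disc in the half plane whose points have real part in \<open>[a/3, 3a]\<close>.
\<close>

lemma harnack_unit_disc:
  assumes F: "F holomorphic_on ball 0 1" and pos: "\<And>w. norm w < 1 \<Longrightarrow> Re (F w) > 0"
    and F0: "F 0 = of_real a" and w: "norm w \<le> 1/2"
  shows "Re (F w) \<le> 3 * a \<and> a \<le> 3 * Re (F w)"
proof -
  have a: "a > 0" using pos[of 0] F0 by simp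
  have nz: "F x + of_real a \<noteq> 0" if "norm x < 1" for x
    using pos[OF that] a by (auto simp: complex_eq_iff)
  define H where "H = (\<lambda>w. (F w - of_real a) / (F w + of_real a))"
  have "norm (H w) \<le> norm w"
  proof (rule Schwarz_Lemma(1))
    show "H holomorphic_on ball 0 1"
      unfolding H_def using nz by (auto intro!: holomorphic_intros F)
    show "H 0 = 0" by (simp add: H_def F0)
    show "norm (H z) < 1" if z: "norm z < 1" for z
    proof -
      have "(norm (F z - of_real a))\<^sup>2 < (norm (F z + of_real a))\<^sup>2"
        unfolding cmod_power2 using mult_pos_pos[OF pos[OF z] a] by (simp add: power2_eq_square algebra_simps)
      then have "norm (F z - of_real a) < norm (F z + of_real a)"
        by (rule power2_less_imp_less) simp
      then show "norm (H z) < 1" using nz[OF z] by (simp add: H_def norm_divide)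
    qed
    show "norm w < 1" using w by simp
  qed
  then have "norm (H w) \<le> 1/2" using w by simp
  moreover have "norm (F w + of_real a) > 0" using nz[of w] w by simp
  ultimately have "2 * norm (F w - of_real a) \<le> norm (F w + of_real a)"
    by (simp add: H_def norm_divide field_simps)
  then have "(2 * norm (F w - of_real a))\<^sup>2 \<le> (norm (F w + of_real a))\<^sup>2"
    by (rule power_mono) simp
  then have "4 * ((Re (F w) - a)\<^sup>2 + (Im (F w))\<^sup>2) \<le> (Re (F w) + a)\<^sup>2 + (Im (F w))\<^sup>2"
    by (simp add: power_mult_distrib cmod_power2)
  then have "(3 * Re (F w) - a) * (Re (F w) - 3 * a) \<le> - 3 * (Im (F w))\<^sup>2"
    by (simp add: power2_eq_square algebra_simps)
  also have "\<dots> \<le> 0" by simp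
  finally have "(3 * Re (F w) - a) * (Re (F w) - 3 * a) \<le> 0" .
  moreover have "Re (F w) > 0" using pos[of w] w by simp
  ultimately show ?thesis using a by (auto simp: mult_le_0_iff)
qed

lemma harmonic_on_ball_eq_Re:
  assumes "harmonic_on v (ball z r)" "r > 0"
  obtains F where "F holomorphic_on ball z r" "\<And>w. w \<in> ball z r \<Longrightarrow> Re (F w) = v w"
    "Im (F z) = 0"
proof -
  obtain f where f: "f holomorphic_on ball z r" and
    v: "\<And>w. w \<in> ball z r \<Longrightarrow> (v has_derivative (\<lambda>h. Re (f w * h))) (at w)"
    using assms(1) unfolding harmonic_on_iff_holomorphic_gradient by blast
  obtain G where "\<And>x. x \<in> ball z r \<Longrightarrow> (G has_field_derivative f x) (at x within ball z r)"
    using holomorphic_convex_primitive'[OF convex_ball open_ball f] by blast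
  then have G: "(G has_field_derivative f x) (at x)" if "x \<in> ball z r" for x
    using that by (metis at_within_open open_ball)
  have "((\<lambda>w. Re (G w) - v w) has_derivative (\<lambda>h. 0)) (at w within ball z r)" if "w \<in> ball z r" for w
  proof -
    have "((\<lambda>w. Re (G w) - v w) has_derivative (\<lambda>h. Re (f w * h) - Re (f w * h))) (at w)"
      using G[OF that] v[OF that] unfolding has_field_derivative_def
      by (intro has_derivative_diff has_derivative_Re)
    then show ?thesis by (simp add: has_derivative_at_withinI)
  qed
  from has_derivative_zero_constant[OF convex_ball this]
  obtain c where c: "\<And>w. w \<in> ball z r \<Longrightarrow> Re (G w) - v w = c" by blast
  show ?thesis
  proof
    show "(\<lambda>w. G w - of_real c - \<i> * of_real (Im (G z))) holomorphic_on ball z r"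
    proof (intro holomorphic_intros)
      show "G holomorphic_on ball z r"
        unfolding holomorphic_on_open[OF open_ball]
      proof
        show "\<exists>f'. (G has_field_derivative f') (at x)" if "x \<in> ball z r" for x
          by (rule exI, rule G[OF that])
      qed
    qed
  qed (use c in \<open>auto simp: algebra_simps\<close>)
qed

lemma harnack_ball:
  assumes v: "harmonic_on v (ball z r)" and nonneg: "\<And>w. w \<in> ball z r \<Longrightarrow> v w \<ge> 0"
    and y: "dist z y \<le> r / 2" "r > 0"
  shows "v y \<le> 3 * v z \<and> v z \<le> 3 * v y"
proof -
  obtain F where F: "F holomorphic_on ball z r" "\<And>w. w \<in> ball z r \<Longrightarrow> Re (F w) = v w"
    "Im (F z) = 0" using harmonic_on_ball_eq_Re[OF v y(2)] by blast
  have "v y + e \<le> 3 * (v z + e) \<and> v z + e \<le> 3 * (v y + e)" if e: "e > 0" for e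
  proof -
    \<comment> \<open>Adding \<open>e\<close> makes the real part strictly positive, as the Schwarz lemma argument needs.\<close>
    define G where "G = (\<lambda>w. F (z + of_real r * w) + of_real e)"
    have in_ball: "z + of_real r * w \<in> ball z r" if "norm w < 1" for w
      using that y(2) by (simp add: dist_norm norm_mult)
    have "(F \<circ> (\<lambda>w. z + of_real r * w)) holomorphic_on ball 0 1"
      by (rule holomorphic_on_compose_gen[OF _ F(1)]) (auto intro!: holomorphic_intros in_ball)
    then have "G holomorphic_on ball 0 1" unfolding G_def o_def by (intro holomorphic_intros)
    moreover have "Re (G w) > 0" if "norm w < 1" for w
      using F(2)[OF in_ball[OF that]] nonneg[OF in_ball[OF that]] e by (simp add: G_def)
    moreover have "G 0 = of_real (v z + e)"
      using F(2)[of z] F(3) y(2) by (simp add: G_def complex_eq_iff)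
    moreover have "norm ((y - z) / of_real r) \<le> 1/2"
      using y by (simp add: norm_divide dist_norm norm_minus_commute)
    ultimately have "Re (G ((y - z) / of_real r)) \<le> 3 * (v z + e) \<and> v z + e \<le> 3 * Re (G ((y - z) / of_real r))"
      by (rule harnack_unit_disc)
    moreover have "Re (G ((y - z) / of_real r)) = v y + e"
      using F(2)[of y] y by (simp add: G_def)
    ultimately show ?thesis by simp
  qed
  from this[of "e / 2" for e] have "v y \<le> 3 * v z + e \<and> v z \<le> 3 * v y + e" if "e > 0" for e
    using that by (fastforce simp: field_simps)
  then show ?thesis by (auto intro: field_le_epsilon)
qed

text \<open>
  By Harnack's inequality the set where the minimum is attained contains, with each interior point
  of \<open>B\<close>, a disc around it. So a rightmost point of this set lies on the frontier.
\<close>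

lemma harmonic_minimum_principle:
  assumes B: "open B" "bounded B" and v: "harmonic_on v B" and cont: "continuous_on (closure B) v"
    and bd: "\<And>z. z \<in> frontier B \<Longrightarrow> v z \<ge> a" and z: "z \<in> B"
  shows "v z \<ge> a"
proof -
  have comp: "compact (closure B)" using B(2) by simp
  have ne: "closure B \<noteq> {}" using z closure_subset by blast
  obtain x0 where x0: "x0 \<in> closure B" "\<And>y. y \<in> closure B \<Longrightarrow> v x0 \<le> v y"
    using continuous_attains_inf[OF comp ne cont] by blast
  define M where "M = {x \<in> closure B. v x = v x0}"
  have "compact M"
  proof -
    have "M = closure B \<inter> (closure B \<inter> v -` {v x0})" by (auto simp: M_def)
    also have "compact \<dots>"
      using comp continuous_closed_preimage[OF cont closed_closure closed_singleton]
      by (rule compact_Int_closed)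
    finally show ?thesis .
  qed
  moreover have "M \<noteq> {}" using x0 by (auto simp: M_def)
  ultimately obtain x where x: "x \<in> M" and rightmost: "\<And>y. y \<in> M \<Longrightarrow> Re y \<le> Re x"
    using continuous_attains_sup[of M Re] continuous_on_Re[OF continuous_on_id] by blast
  have "x \<notin> B"
  proof
    assume "x \<in> B"
    then obtain r where r: "r > 0" "ball x r \<subseteq> B" using B(1) open_contains_ball by blast
    have "harmonic_on (\<lambda>w. v w - v x0) (ball x r)"
      by (intro harmonic_on_diff harmonic_on_const harmonic_on_subset[OF v]) (use r in auto)
    moreover have "v w - v x0 \<ge> 0" if "w \<in> ball x r" for w
      using x0(2) that r closure_subset by fastforce
    ultimately have "v (x + of_real (r/2)) - v x0 \<le> 3 * (v x - v x0)"
      using harnack_ball[of "\<lambda>w. v w - v x0" x r "x + of_real (r/2)"] r by (auto simp: dist_norm)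
    moreover have "v x = v x0" using x by (simp add: M_def)
    moreover have in_cl: "x + of_real (r/2) \<in> closure B"
      using r closure_subset by (fastforce simp: dist_norm)
    ultimately have "x + of_real (r/2) \<in> M"
      using x0(2)[OF in_cl] by (simp add: M_def)
    then show False using rightmost r by fastforce
  qed
  then have "x \<in> frontier B" using x B(1) by (simp add: M_def frontier_def interior_open)
  then have "a \<le> v x0" using bd[of x] x by (simp add: M_def)
  then show ?thesis using x0(2)[of z] z closure_subset by fastforce
qed

lemma harmonic_minimum_principle_unbounded:
  assumes B: "open B" and v: "harmonic_on v B" and cont: "continuous_on (closure B) v"
    and bd: "\<And>z. z \<in> frontier B \<Longrightarrow> v z \<ge> a" and inf: "\<forall>\<^sub>F z in at_infinity. v z \<ge> a"
    and z: "z \<in> B"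
  shows "v z \<ge> a"
proof -
  obtain R where R: "\<And>w. norm w \<ge> R \<Longrightarrow> v w \<ge> a"
    using inf unfolding eventually_at_infinity by blast
  define S where "S = max R (norm z + 1)"
  have S: "S > 0" "norm z < S" "\<And>w. norm w \<ge> S \<Longrightarrow> v w \<ge> a"
    using R norm_ge_zero[of z] by (auto simp: S_def simp del: norm_ge_zero)
  show ?thesis
  proof (rule harmonic_minimum_principle)
    show "open (B \<inter> ball 0 S)" "bounded (B \<inter> ball 0 S)" using B by auto
    show "harmonic_on v (B \<inter> ball 0 S)" by (rule harmonic_on_subset[OF v]) (use B in auto)
    show "continuous_on (closure (B \<inter> ball 0 S)) v"
      by (rule continuous_on_subset[OF cont]) (simp add: closure_mono)
    show "z \<in> B \<inter> ball 0 S" using z S by simp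
    show "v w \<ge> a" if "w \<in> frontier (B \<inter> ball 0 S)" for w
    proof -
      have "w \<in> frontier B \<or> w \<in> frontier (ball 0 S)" using that frontier_Int_subset by blast
      then show ?thesis using bd S by (auto simp: frontier_ball)
    qed
  qed
qed

text \<open>
  Used for two open sets around \<open>E\<close>: where the Green function is small, and where a Lagrange
  polynomial is almost bounded by the Lebesgue constant.
\<close>

lemma compact_infdist_neighbourhood:
  fixes E :: "complex set"
  assumes "compact E" "E \<noteq> {}" "open U" "E \<subseteq> U"
  obtains \<eta> where "\<eta> > 0" "\<And>z. infdist z E \<le> \<eta> \<Longrightarrow> z \<in> U"
proof -
  obtain \<eta> where \<eta>: "\<eta> > 0" "(\<Union>x\<in>E. cball x \<eta>) \<subseteq> U"
    using compact_subset_open_imp_cball_epsilon_subset[OF assms(1,3,4)] by blast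
  have "z \<in> U" if "infdist z E \<le> \<eta>" for z
  proof -
    obtain x where "x \<in> E" "infdist z E = dist z x"
      using infdist_attains_inf[OF compact_imp_closed[OF assms(1)] assms(2)] by blast
    then have "z \<in> cball x \<eta>" using that by (simp add: dist_commute)
    then show ?thesis using \<eta>(2) \<open>x \<in> E\<close> by blast
  qed
  then show ?thesis using that \<eta>(1) by blast
qed

section \<open>Harnack's inequality on compact sets\<close>

text \<open>
  Nonnegativity is demanded only on the compact set \<open>L\<close>, because the functions to which the
  inequality is applied are bounded below on compact subsets of \<open>D\<close> only. The points belong to \<open>L\<close>
  so that the constant may be enlarged.
\<close>

definition harnack_comparable :: "complex set \<Rightarrow> real \<Rightarrow> complex set \<Rightarrow> complex \<Rightarrow> complex \<Rightarrow> bool" where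
  "harnack_comparable D C L x y \<longleftrightarrow> C \<ge> 0 \<and> compact L \<and> {x, y} \<subseteq> L \<and> L \<subseteq> D \<and>
     (\<forall>v. harmonic_on v D \<longrightarrow> (\<forall>w\<in>L. v w \<ge> 0) \<longrightarrow> v x \<le> C * v y \<and> v y \<le> C * v x)"

lemma harnack_comparable_sym: "harnack_comparable D C L x y \<Longrightarrow> harnack_comparable D C L y x"
  unfolding harnack_comparable_def by auto

lemma harnack_comparable_trans:
  assumes 1: "harnack_comparable D C L x y" and 2: "harnack_comparable D C' L' y z"
  shows "harnack_comparable D (C * C') (L \<union> L') x z"
  unfolding harnack_comparable_def
proof (intro conjI allI impI)
  fix v assume v: "harmonic_on v D" "\<forall>w\<in>L \<union> L'. 0 \<le> v w"
  have C: "C \<ge> 0" "C' \<ge> 0" using 1 2 unfolding harnack_comparable_def by auto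
  have xy: "v x \<le> C * v y" "v y \<le> C * v x" using 1 v unfolding harnack_comparable_def by auto
  have yz: "v y \<le> C' * v z" "v z \<le> C' * v y" using 2 v unfolding harnack_comparable_def by auto
  show "v x \<le> C * C' * v z" using xy(1) mult_left_mono[OF yz(1) C(1)] by simp
  show "v z \<le> C * C' * v x" using yz(2) mult_left_mono[OF xy(2) C(2)] by (simp add: mult_ac)
qed (use 1 2 in \<open>auto simp: harnack_comparable_def\<close>)

lemma harnack_comparable_mono:
  assumes 1: "harnack_comparable D C L x y" and C: "C \<le> C'" and L: "L \<subseteq> L'" "compact L'" "L' \<subseteq> D"
  shows "harnack_comparable D C' L' x y"
  unfolding harnack_comparable_def
proof (intro conjI allI impI)
  fix v assume v: "harmonic_on v D" "\<forall>w\<in>L'. 0 \<le> v w"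
  have "\<forall>w\<in>L. 0 \<le> v w" using v(2) L(1) by blast
  then have le: "v x \<le> C * v y" "v y \<le> C * v x" and nn: "v x \<ge> 0" "v y \<ge> 0"
    using 1 v(1) unfolding harnack_comparable_def by auto
  show "v x \<le> C' * v y" using le(1) mult_right_mono[OF C nn(2)] by simp
  show "v y \<le> C' * v x" using le(2) mult_right_mono[OF C nn(1)] by simp
qed (use assms in \<open>auto simp: harnack_comparable_def\<close>)

lemma harnack_comparable_nearby:
  assumes "open D" "x \<in> D"
  obtains r where "r > 0" "\<And>y. y \<in> ball x r \<Longrightarrow> harnack_comparable D 3 (cball x (2 * r)) x y"
    "cball x (2 * r) \<subseteq> D"
proof -
  obtain R where R: "R > 0" "cball x R \<subseteq> D" using assms open_contains_cball by blast
  show ?thesis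
  proof (rule that)
    show "R / 2 > 0" "cball x (2 * (R/2)) \<subseteq> D" using R by simp_all
    fix y assume y: "y \<in> ball x (R / 2)"
    have "v y \<le> 3 * v x \<and> v x \<le> 3 * v y"
      if "harmonic_on v D" "\<forall>w\<in>cball x R. v w \<ge> 0" for v
    proof (rule harnack_ball)
      show "harmonic_on v (ball x R)"
        by (rule harmonic_on_subset[OF that(1)]) (use R in auto)
    qed (use that R y in auto)
    then show "harnack_comparable D 3 (cball x (2 * (R / 2))) x y"
      using R y unfolding harnack_comparable_def by auto
  qed
qed

text \<open>
  The points comparable with \<open>a\<close> form a subset of \<open>D\<close> that is both open and closed in \<open>D\<close>, since all
  points of a small disc are comparable with its centre.
\<close>

lemma harnack_comparable_connected:
  assumes D: "open D" "connected D" and ab: "a \<in> D" "b \<in> D"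
  shows "\<exists>C L. harnack_comparable D C L a b"
  using D(2) ab
proof (rule connected_induction_simple)
  show "\<exists>C L. harnack_comparable D C L a a"
    by (intro exI[of _ 1] exI[of _ "{a}"]) (simp add: harnack_comparable_def ab)
  fix x assume "x \<in> D"
  then obtain r where r: "r > 0" "cball x (2 * r) \<subseteq> D"
    "\<And>y. y \<in> ball x r \<Longrightarrow> harnack_comparable D 3 (cball x (2 * r)) x y"
    using harnack_comparable_nearby[OF D(1)] by metis
  have sub: "ball x r \<subseteq> D" using r(1,2) by (force simp: subset_iff)
  show "\<exists>T. openin (top_of_set D) T \<and> x \<in> T \<and>
     (\<forall>y\<in>T. \<forall>y'\<in>T. (\<exists>C L. harnack_comparable D C L a y) \<longrightarrow> (\<exists>C L. harnack_comparable D C L a y'))"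
  proof (intro exI[of _ "ball x r"] conjI ballI impI)
    show "openin (top_of_set D) (ball x r)" using sub by (simp add: D(1) openin_open_eq)
    show "x \<in> ball x r" using r by simp
    fix y y' assume y: "y \<in> ball x r" "y' \<in> ball x r" "\<exists>C L. harnack_comparable D C L a y"
    then obtain C L where "harnack_comparable D C L a y" by blast
    from harnack_comparable_trans[OF harnack_comparable_trans[OF this harnack_comparable_sym[OF r(3)[OF y(1)]]]
        r(3)[OF y(2)]]
    show "\<exists>C L. harnack_comparable D C L a y'" by blast
  qed
qed

lemma harnack_compact:
  fixes D K :: "complex set"
  assumes D: "open D" "connected D" and K: "compact K" "K \<subseteq> D"
  obtains C L where "C > 0" "compact L" "L \<subseteq> D"
    "\<And>v x y. harmonic_on v D \<Longrightarrow> (\<And>w. w \<in> L \<Longrightarrow> v w \<ge> 0) \<Longrightarrow> x \<in> K \<Longrightarrow> y \<in> K \<Longrightarrow> v x \<le> C * v y"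
proof (cases "K = {}")
  case True
  show ?thesis by (rule that[of 1 "{}"]) (auto simp: True)
next
  case False
  then obtain a where a: "a \<in> K" by blast
  have "\<exists>C L r. harnack_comparable D C L a x \<and> r > 0 \<and> cball x (2 * r) \<subseteq> D \<and>
    (\<forall>y \<in> ball x r. harnack_comparable D 3 (cball x (2 * r)) x y)" if "x \<in> K" for x
    using harnack_comparable_connected[OF D, of a x] harnack_comparable_nearby[OF D(1), of x] a that K(2)
    by (metis subsetD)
  then obtain C L r where CLr: "\<And>x. x \<in> K \<Longrightarrow> harnack_comparable D (C x) (L x) a x"
      "\<And>x. x \<in> K \<Longrightarrow> r x > 0" "\<And>x. x \<in> K \<Longrightarrow> cball x (2 * r x) \<subseteq> D"
      "\<And>x y. x \<in> K \<Longrightarrow> y \<in> ball x (r x) \<Longrightarrow> harnack_comparable D 3 (cball x (2 * r x)) x y"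
    by metis
  have "K \<subseteq> (\<Union>x\<in>K. ball x (r x))" using CLr(2) by force
  then obtain X where X: "X \<subseteq> K" "finite X" "K \<subseteq> (\<Union>x\<in>X. ball x (r x))"
    using compactE_image[OF K(1), of K "\<lambda>x. ball x (r x)"] by auto
  define A where "A = 1 + (\<Sum>x\<in>X. C x * 3)"
  define M where "M = (\<Union>x\<in>X. L x \<union> cball x (2 * r x))"
  have C0: "C x \<ge> 0" if "x \<in> X" for x using CLr(1) X that unfolding harnack_comparable_def by blast
  have A: "A > 0" using sum_nonneg[of X "\<lambda>x. C x * 3"] C0 by (simp add: A_def)
  have M: "compact M" "M \<subseteq> D"
  proof -
    show "compact M" unfolding M_def
      using X CLr(1) by (intro compact_UN compact_Un) (auto simp: harnack_comparable_def)
    have "L x \<union> cball x (2 * r x) \<subseteq> D" if "x \<in> X" for x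
      using CLr(1)[of x] CLr(3)[of x] X that unfolding harnack_comparable_def by blast
    then show "M \<subseteq> D" unfolding M_def by blast
  qed
  have key: "harnack_comparable D A M a b" if b: "b \<in> K" for b
  proof -
    obtain x where x: "x \<in> X" "b \<in> ball x (r x)" using X b by blast
    have xK: "x \<in> K" using x X by blast
    show ?thesis
    proof (rule harnack_comparable_mono[OF harnack_comparable_trans[OF CLr(1)[OF xK] CLr(4)[OF xK x(2)]]])
      have "C x * 3 \<le> (\<Sum>x\<in>X. C x * 3)" using X x C0 by (intro member_le_sum) auto
      then show "C x * 3 \<le> A" by (simp add: A_def)
      show "L x \<union> cball x (2 * r x) \<subseteq> M" using x(1) by (auto simp: M_def)
    qed (rule M)+
  qed
  have "harnack_comparable D (A * A) (M \<union> M) x y" if "x \<in> K" "y \<in> K" for x y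
    using harnack_comparable_trans[OF harnack_comparable_sym[OF key] key] that .
  then have "v x \<le> (A * A) * v y"
    if "harmonic_on v D" "\<And>w. w \<in> M \<Longrightarrow> v w \<ge> 0" "x \<in> K" "y \<in> K" for v x y
    using that unfolding harnack_comparable_def by simp
  moreover have "A * A > 0" using A by simp
  ultimately show ?thesis using that M by blast
qed

section \<open>The Green function of the complement\<close>

text \<open>
  A bounded component of the complement would lie in the polynomial hull, by the maximum modulus
  principle for polynomials.
\<close>

lemma connected_complement_polynomially_convex:
  assumes E: "compact E" "E \<noteq> {}" "polynomially_convex E"
  shows "connected (- E)"
proof -
  have unb: "\<not> bounded C" if C: "C \<in> components (- E)" for C
  proof
    assume bC: "bounded C"
    obtain z where z: "z \<in> C" using in_components_nonempty[OF C] by blast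
    have "norm (poly p z) \<le> (SUP w\<in>E. norm (poly p w))" for p
    proof (rule maximum_modulus_frontier[OF _ _ bC _ z])
      show "poly p holomorphic_on interior C" "continuous_on (closure C) (poly p)"
        by (auto intro!: holomorphic_intros continuous_intros)
      fix w assume "w \<in> frontier C"
      then have w: "w \<in> E"
        using frontier_of_components_closed_complement[OF compact_imp_closed[OF E(1)] C] by blast
      have "bdd_above ((\<lambda>w. norm (poly p w)) ` E)"
        by (intro bounded_imp_bdd_above compact_imp_bounded compact_continuous_image E(1) continuous_intros)
      then show "norm (poly p w) \<le> (SUP w\<in>E. norm (poly p w))" using w by (intro cSUP_upper)
    qed
    then have "z \<in> poly_convex_hull E" by (simp add: poly_convex_hull_def)
    then have "z \<in> E" using E(3) by (simp add: polynomially_convex_def)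
    then show False using in_components_subset[OF C] z by blast
  qed
  have "bounded (- (- E))" using E(1) compact_imp_bounded by simp
  then show ?thesis
    unfolding connected_eq_connected_components_eq
    using cobounded_unique_unbounded_components unb by fastforce
qed

text \<open>
  The condition on the outer domain says that \<open>E\<close> is its own polynomial hull; it makes the
  complement of \<open>E\<close> the domain of \<open>g\<close>.
\<close>

locale green =
  fixes E :: "complex set" and g :: "complex \<Rightarrow> real" and \<gamma> :: real
  assumes compact_E: "compact E" and E_ne: "E \<noteq> {}" and outer: "outer_domain E = - E"
    and green: "green_function E g \<gamma>"
begin

lemma open_compl: "open (- E)"
  using compact_E compact_imp_closed by blast

lemma harmonic_g: "harmonic_on g (- E)"
  and g_pos: "z \<notin> E \<Longrightarrow> g z > 0"
  and g_minus_ln: "((\<lambda>z. g z - ln (norm z)) \<longlongrightarrow> \<gamma>) at_infinity"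
  using green outer by (auto simp: green_function_def)

lemma g_at_top: "filterlim g at_top at_infinity"
proof -
  have "filterlim (\<lambda>z::complex. ln (norm z)) at_top at_infinity"
    by (rule filterlim_compose[OF ln_at_top filterlim_norm_at_top])
  from filterlim_tendsto_add_at_top[OF g_minus_ln this] show ?thesis by simp
qed

lemma infdist_pos_iff: "infdist z E > 0 \<longleftrightarrow> z \<notin> E"
  using in_closed_iff_infdist_zero[OF compact_imp_closed[OF compact_E] E_ne, of z] infdist_nonneg[of z E]
  by auto

lemma g_small_near:
  assumes "\<epsilon> > 0"
  obtains \<eta> where "\<eta> > 0" "\<And>z. z \<notin> E \<Longrightarrow> infdist z E \<le> \<eta> \<Longrightarrow> g z < \<epsilon>"
proof -
  have "\<exists>r>0. \<forall>z\<in>ball x r. z \<notin> E \<longrightarrow> g z < \<epsilon>" if x: "x \<in> E" for x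
  proof (cases "x \<in> interior E")
    case True
    then obtain r where "r > 0" "ball x r \<subseteq> E" by (meson mem_interior)
    then show ?thesis by blast
  next
    case False
    have "x \<in> closure E" using x closure_subset by blast
    with False have "x \<in> frontier (- E)" unfolding frontier_complement by (simp add: frontier_def)
    then have "(g \<longlongrightarrow> 0) (at x within (- E))"
      using green outer by (auto simp: green_function_def)
    then have "\<forall>\<^sub>F z in at x within (- E). g z < \<epsilon>" using assms by (rule order_tendstoD)
    then obtain r where r: "r > 0" "\<forall>z\<in>- E. z \<noteq> x \<and> dist z x < r \<longrightarrow> g z < \<epsilon>"
      unfolding eventually_at by blast
    have "\<forall>z\<in>ball x r. z \<notin> E \<longrightarrow> g z < \<epsilon>" using r(2) x by (auto simp: dist_commute)
    then show ?thesis using r(1) by blast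
  qed
  then obtain r where r: "\<And>x. x \<in> E \<Longrightarrow> r x > 0"
    "\<And>x z. x \<in> E \<Longrightarrow> z \<in> ball x (r x) \<Longrightarrow> z \<notin> E \<Longrightarrow> g z < \<epsilon>" by metis
  have "open (\<Union>x\<in>E. ball x (r x))" "E \<subseteq> (\<Union>x\<in>E. ball x (r x))" using r(1) by auto
  from compact_infdist_neighbourhood[OF compact_E E_ne this]
  obtain \<eta> where "\<eta> > 0" "\<And>z. infdist z E \<le> \<eta> \<Longrightarrow> z \<in> (\<Union>x\<in>E. ball x (r x))" by blast
  then show ?thesis using that r(2) by blast
qed

text \<open>
  The multiple \<open>\<delta> g\<close> is positive and tends to infinity, so it pushes \<open>h + \<delta> g\<close> above \<open>a\<close> near
  infinity, and \<open>\<delta>\<close> is arbitrary. The point at infinity therefore counts as an interior point of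
  the domain rather than as a boundary point.
\<close>

lemma minimum_principle_at_infinity:
  assumes h: "harmonic_on h (- E)" and lim: "(h \<longlongrightarrow> \<beta>) at_infinity"
    and B: "open B" "closure B \<subseteq> - E" and bd: "\<And>z. z \<in> frontier B \<Longrightarrow> h z \<ge> a"
    and z: "z \<in> B"
  shows "h z \<ge> a"
proof -
  have gz: "g z > 0" using g_pos B(2) z closure_subset by blast
  have "h z + \<delta> * g z \<ge> a" if "\<delta> > 0" for \<delta>
  proof (rule harmonic_minimum_principle_unbounded[OF B(1) _ _ _ _ z])
    have harm: "harmonic_on (\<lambda>w. h w + \<delta> * g w) (- E)"
      by (intro harmonic_on_add harmonic_on_cmult h harmonic_g)
    then show "harmonic_on (\<lambda>w. h w + \<delta> * g w) B"
      by (rule harmonic_on_subset) (use B closure_subset in blast)+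
    show "continuous_on (closure B) (\<lambda>w. h w + \<delta> * g w)"
      using harmonic_on_imp_continuous_on[OF harm] B(2) by (rule continuous_on_subset)
    show "a \<le> h w + \<delta> * g w" if w: "w \<in> frontier B" for w
    proof -
      have "w \<notin> E" using w B(2) by (auto simp: frontier_def)
      then show ?thesis using bd[OF w] mult_pos_pos[OF \<open>\<delta> > 0\<close> g_pos[of w]] by simp
    qed
    have "filterlim (\<lambda>w. \<delta> * g w) at_top at_infinity"
      using filterlim_tendsto_pos_mult_at_top[OF tendsto_const that g_at_top] .
    from filterlim_tendsto_add_at_top[OF lim this]
    show "\<forall>\<^sub>F w in at_infinity. a \<le> h w + \<delta> * g w" by (simp add: filterlim_at_top)
  qed
  from this[of "e / g z" for e] have "a \<le> h z + e" if "e > 0" for e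
    using that gz by simp
  then show ?thesis by (rule field_le_epsilon)
qed

text \<open>
  The form in which the minimum principle is used below: bounds near \<open>E\<close> carry over to the value at
  infinity.
\<close>

lemma exterior_lower_bound:
  assumes h: "harmonic_on h (- E)" and lim: "(h \<longlongrightarrow> \<beta>) at_infinity" and \<eta>: "\<eta> > 0"
    and bd: "\<And>z. infdist z E = \<eta> \<Longrightarrow> h z \<ge> a"
  shows "\<And>z. infdist z E \<ge> \<eta> \<Longrightarrow> h z \<ge> a" and "\<beta> \<ge> a"
proof -
  let ?B = "{z. infdist z E > \<eta>}"
  have op: "open ?B" by (intro open_Collect_less continuous_intros)
  have "closure ?B \<subseteq> {z. infdist z E \<ge> \<eta>}"
    by (rule closure_minimal) (auto intro!: closed_Collect_le continuous_intros)
  then have cl: "closure ?B \<subseteq> - E" and "frontier ?B \<subseteq> {z. infdist z E = \<eta>}"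
    using \<eta> op by (auto simp: frontier_def interior_open)
  then have B: "h z \<ge> a" if "infdist z E > \<eta>" for z
    using minimum_principle_at_infinity[OF h lim op cl, of a z] that bd by blast
  then show "\<And>z. infdist z E \<ge> \<eta> \<Longrightarrow> h z \<ge> a" using bd by (metis order_le_less)
  have "compact {z. infdist z E \<le> \<eta>}" using compact_infdist_le[OF E_ne compact_E \<eta>] .
  then obtain R where R: "\<And>z. infdist z E \<le> \<eta> \<Longrightarrow> norm z \<le> R"
    using compact_imp_bounded bounded_iff by (metis mem_Collect_eq)
  have "h z \<ge> a" if "norm z \<ge> R + 1" for z using B[of z] R[of z] that by fastforce
  then have "\<forall>\<^sub>F z in at_infinity. h z \<ge> a" unfolding eventually_at_infinity by blast
  then show "\<beta> \<ge> a" by (rule tendsto_lowerbound[OF lim]) (rule trivial_limit_at_infinity)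
qed

text \<open>
  The difference of two Green functions is almost nonnegative close to \<open>E\<close>, hence also at infinity.
\<close>

lemma robin_le:
  assumes "green E g' \<gamma>'" shows "\<gamma> \<le> \<gamma>'"
proof -
  interpret g': green E g' \<gamma>' by fact
  have "\<gamma>' - \<gamma> \<ge> - \<epsilon>" if \<epsilon>: "\<epsilon> > 0" for \<epsilon>
  proof -
    obtain \<eta> where \<eta>: "\<eta> > 0" "\<And>z. z \<notin> E \<Longrightarrow> infdist z E \<le> \<eta> \<Longrightarrow> g z < \<epsilon>"
      using g_small_near[OF \<epsilon>] by blast
    show ?thesis
    proof (rule exterior_lower_bound(2)[OF _ _ \<eta>(1)])
      show "harmonic_on (\<lambda>z. g' z - g z) (- E)"
        by (intro harmonic_on_diff harmonic_g g'.harmonic_g)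
      show "((\<lambda>z. g' z - g z) \<longlongrightarrow> \<gamma>' - \<gamma>) at_infinity"
        using tendsto_diff[OF g'.g_minus_ln g_minus_ln] by simp
      show "g' z - g z \<ge> - \<epsilon>" if "infdist z E = \<eta>" for z
      proof -
        have "z \<notin> E" using that \<eta>(1) infdist_pos_iff[of z] by simp
        then show ?thesis using \<eta>(2)[of z] g'.g_pos[of z] that by simp
      qed
    qed
  qed
  from this have "\<gamma> \<le> \<gamma>' + \<epsilon>" if "\<epsilon> > 0" for \<epsilon> using that by fastforce
  then show ?thesis by (rule field_le_epsilon)
qed

lemma log_capacity_eq: "log_capacity E = exp (- \<gamma>)"
proof -
  have "(THE \<gamma>'. \<exists>g'. green_function E g' \<gamma>') = \<gamma>"
  proof (rule the_equality)
    show "\<exists>g'. green_function E g' \<gamma>" using green by blast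
    fix \<gamma>' assume "\<exists>g'. green_function E g' \<gamma>'"
    then obtain g' where "green_function E g' \<gamma>'" by blast
    then have g': "green E g' \<gamma>'" using compact_E E_ne outer by unfold_locales
    interpret g': green E g' \<gamma>' by fact
    show "\<gamma>' = \<gamma>" using robin_le[OF g'] g'.robin_le[OF green_axioms] by simp
  qed
  then show ?thesis by (simp add: log_capacity_def)
qed

text \<open>
  A function that vanishes at infinity cannot be positive on the whole of a large circle, since
  its positive minimum there would be a lower bound at infinity. So Harnack's inequality can
  be applied to \<open>v + s\<close> with a reference point on the circle where \<open>v + s \<le> s\<close>.
\<close>

lemma harnack_vanishing_at_infinity:
  assumes conn: "connected (- E)" and K: "compact K" "K \<subseteq> - E"
  obtains C L where "C > 0" "compact L" "L \<subseteq> - E"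
    "\<And>v s x. harmonic_on v (- E) \<Longrightarrow> (v \<longlongrightarrow> 0) at_infinity \<Longrightarrow> s \<ge> 0 \<Longrightarrow>
       (\<And>w. w \<in> L \<Longrightarrow> v w \<ge> - s) \<Longrightarrow> x \<in> K \<Longrightarrow> v x \<le> C * s"
proof -
  obtain R where R: "R > 0" "E \<subseteq> ball 0 R"
    using bounded_subset_ballD[OF compact_imp_bounded[OF compact_E]] by blast
  have "compact (K \<union> sphere 0 R)" "K \<union> sphere 0 R \<subseteq> - E" using K R by auto
  from harnack_compact[OF open_compl conn this]
  obtain C L where CL: "C > 0" "compact L" "L \<subseteq> - E" and
    har: "\<And>v x y. harmonic_on v (- E) \<Longrightarrow> (\<And>w. w \<in> L \<Longrightarrow> v w \<ge> 0) \<Longrightarrow> x \<in> K \<union> sphere 0 R \<Longrightarrow>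
      y \<in> K \<union> sphere 0 R \<Longrightarrow> v x \<le> C * v y" by blast
  show ?thesis
  proof (rule that[OF CL])
    fix v :: "complex \<Rightarrow> real" and s x
    assume v: "harmonic_on v (- E)" "(v \<longlongrightarrow> 0) at_infinity" and s: "s \<ge> 0"
      and low: "\<And>w. w \<in> L \<Longrightarrow> v w \<ge> - s" and x: "x \<in> K"
    have "\<exists>y\<in>sphere 0 R. v y \<le> 0"
    proof -
      have "continuous_on (sphere 0 R) v"
        using harmonic_on_imp_continuous_on[OF v(1)] by (rule continuous_on_subset) (use R in auto)
      moreover have "sphere (0::complex) R \<noteq> {}" using R by simp
      ultimately obtain y where y: "y \<in> sphere 0 R" "\<And>w. w \<in> sphere 0 R \<Longrightarrow> v y \<le> v w"
        using continuous_attains_inf[OF compact_sphere] by blast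
      let ?B = "- cball (0::complex) R"
      have cl: "closure ?B \<subseteq> - E" using R(2) by (simp add: closure_complement)
      have fr: "frontier ?B = sphere 0 R" using R(1) by (simp add: frontier_complement)
      have "v w \<ge> v y" if "w \<in> ?B" for w
        by (rule minimum_principle_at_infinity[OF v _ cl _ that]) (use y(2) fr in auto)
      then have "\<forall>\<^sub>F w in at_infinity. v w \<ge> v y"
        unfolding eventually_at_infinity by (intro exI[of _ "R + 1"]) auto
      then have "v y \<le> 0" by (rule tendsto_lowerbound[OF v(2)]) (rule trivial_limit_at_infinity)
      then show ?thesis using y(1) by blast
    qed
    then obtain y where y: "y \<in> sphere 0 R" "v y \<le> 0" by blast
    have "v x + s \<le> C * (v y + s)"
    proof (rule har)
      show "harmonic_on (\<lambda>z. v z + s) (- E)"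
        by (intro harmonic_on_add v harmonic_on_const open_compl)
    qed (use low x y in \<open>force+\<close>)
    also have "\<dots> \<le> C * s" using y CL(1) by (intro mult_left_mono) auto
    finally show "v x \<le> C * s" using s by simp
  qed
qed

end

section \<open>Node polynomials and Lagrange interpolation\<close>

text \<open>
  The minimum of the absolute values of the derivative of \<open>\<omega>(z) = \<Prod>\<^sub>j (z - \<zeta>\<^sub>j)\<close> at the nodes.
\<close>

definition node_gap :: "nat \<Rightarrow> (nat \<Rightarrow> complex) \<Rightarrow> real" where
  "node_gap n \<zeta> = (MIN k\<in>{0..n}. norm (\<Prod>j\<in>{0..n} - {k}. \<zeta> j - \<zeta> k))"

text \<open>
  This is \<open>ln \<bar>\<omega>(z)\<bar> / (n + 1)\<close>, the logarithmic potential of the normalized counting measure of the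
  nodes up to sign.
\<close>

definition node_potential :: "nat \<Rightarrow> (nat \<Rightarrow> complex) \<Rightarrow> complex \<Rightarrow> real" where
  "node_potential n \<zeta> z = (\<Sum>j=0..n. ln (norm (z - \<zeta> j))) / (n + 1)"

text \<open>
  Both sides are polynomials in \<open>z\<close> of degree at most \<open>n\<close> that agree at the \<open>n + 1\<close> nodes.
\<close>

lemma sum_lagrange_fund:
  assumes inj: "inj_on \<zeta> {0..n}"
  shows "(\<Sum>k=0..n. lagrange_fund n \<zeta> k z) = 1"
proof -
  define L where "L = (\<lambda>k. smult (1 / (\<Prod>j\<in>{0..n} - {k}. \<zeta> k - \<zeta> j)) (\<Prod>j\<in>{0..n} - {k}. [:- \<zeta> j, 1:]))"
  have poly_L: "poly (L k) w = lagrange_fund n \<zeta> k w" for k w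
    by (simp add: L_def lagrange_fund_def poly_prod prod_dividef)
  have deg: "degree (L k) \<le> n" if "k \<le> n" for k
  proof -
    have "degree (L k) \<le> degree (\<Prod>j\<in>{0..n} - {k}. [:- \<zeta> j, 1:])"
      unfolding L_def by (rule degree_smult_le)
    also have "\<dots> \<le> sum (degree \<circ> (\<lambda>j. [:- \<zeta> j, 1:])) ({0..n} - {k})"
      by (rule degree_prod_sum_le) simp
    also have "\<dots> = n" using that by simp
    finally show ?thesis .
  qed
  have lag: "lagrange_fund n \<zeta> k (\<zeta> i) = (if k = i then 1 else 0)" if "k \<le> n" "i \<le> n" for k i
  proof (cases "k = i")
    case True
    have "lagrange_fund n \<zeta> k (\<zeta> k) = (\<Prod>j\<in>{0..n} - {k}. 1)"
      unfolding lagrange_fund_def using inj that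
      by (intro prod.cong refl) (auto simp: inj_on_def)
    then show ?thesis using True by simp
  next
    case False
    then show ?thesis unfolding lagrange_fund_def using that by (auto intro!: bexI[of _ i])
  qed
  have "(\<Sum>k=0..n. L k) = 1"
  proof (rule poly_eqI_degree[of "\<zeta> ` {0..n}"])
    show "poly (\<Sum>k=0..n. L k) x = poly 1 x" if x: "x \<in> \<zeta> ` {0..n}" for x
    proof -
      obtain i where i: "i \<le> n" "x = \<zeta> i" using x by auto
      have "poly (\<Sum>k=0..n. L k) x = (\<Sum>k=0..n. if k = i then 1 else 0)"
        unfolding poly_sum poly_L i(2) by (intro sum.cong) (auto simp: lag i(1))
      then show ?thesis using i by simp
    qed
    have "card (\<zeta> ` {0..n}) = n + 1" using card_image[OF inj] by simp
    then show "degree (\<Sum>k=0..n. L k) < card (\<zeta> ` {0..n})" "degree (1 :: complex poly) < card (\<zeta> ` {0..n})"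
      using degree_sum_le[of "{0..n}" L n] deg by auto
  qed
  from arg_cong[OF this, of "\<lambda>p. poly p z"] show ?thesis by (simp add: poly_sum poly_L)
qed

lemma norm_lagrange_fund:
  "norm (lagrange_fund n \<zeta> k z) =
     (\<Prod>j\<in>{0..n} - {k}. norm (z - \<zeta> j)) / norm (\<Prod>j\<in>{0..n} - {k}. \<zeta> j - \<zeta> k)"
  by (simp add: lagrange_fund_def prod_dividef norm_divide prod_norm norm_minus_commute flip: prod_norm)

lemma node_gap_le: "k \<le> n \<Longrightarrow> node_gap n \<zeta> \<le> norm (\<Prod>j\<in>{0..n} - {k}. \<zeta> j - \<zeta> k)"
  unfolding node_gap_def by (intro Min_le) auto

lemma node_gap_attained:
  obtains k where "k \<le> n" "node_gap n \<zeta> = norm (\<Prod>j\<in>{0..n} - {k}. \<zeta> j - \<zeta> k)"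
proof -
  have "node_gap n \<zeta> \<in> (\<lambda>k. norm (\<Prod>j\<in>{0..n} - {k}. \<zeta> j - \<zeta> k)) ` {0..n}"
    unfolding node_gap_def by (intro Min_in) auto
  then show ?thesis using that by auto
qed

lemma node_gap_pos:
  assumes "inj_on \<zeta> {0..n}" shows "node_gap n \<zeta> > 0"
proof -
  obtain k where "k \<le> n" "node_gap n \<zeta> = norm (\<Prod>j\<in>{0..n} - {k}. \<zeta> j - \<zeta> k)"
    by (rule node_gap_attained)
  then show ?thesis using assms by (auto simp: inj_on_def)
qed

lemma ln_norm_diff_tendsto:
  fixes a :: complex
  shows "((\<lambda>z. ln (norm (z - a)) - ln (norm z)) \<longlongrightarrow> 0) at_infinity"
proof -
  have "((\<lambda>z. 1 - a / z) \<longlongrightarrow> 1 - 0) at_infinity"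
    by (intro tendsto_diff tendsto_const tendsto_divide_0[OF tendsto_const] filterlim_ident)
  then have "((\<lambda>z. ln (norm (1 - a / z))) \<longlongrightarrow> ln (norm (1 - 0 :: complex))) at_infinity"
    by (intro tendsto_ln tendsto_norm) auto
  moreover have "\<forall>\<^sub>F z in at_infinity. ln (norm (1 - a / z)) = ln (norm (z - a)) - ln (norm z)"
    using eventually_not_equal_at_infinity[of 0] eventually_not_equal_at_infinity[of a]
  proof eventually_elim
    case (elim z)
    then have "1 - a / z = (z - a) / z" by (simp add: field_simps)
    then show ?case using elim by (simp add: norm_divide ln_div)
  qed
  ultimately show ?thesis using Lim_transform_eventually by fastforce
qed

lemma bdd_above_lebesgue:
  assumes "compact E"
  shows "bdd_above ((\<lambda>z. \<Sum>j=0..n. norm (lagrange_fund n \<zeta> j z)) ` E)"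
  unfolding lagrange_fund_def divide_inverse
  by (intro bounded_imp_bdd_above compact_imp_bounded compact_continuous_image assms continuous_intros)

lemma sum_lagrange_le_lebesgue_const:
  "compact E \<Longrightarrow> z \<in> E \<Longrightarrow> (\<Sum>j=0..n. norm (lagrange_fund n \<zeta> j z)) \<le> lebesgue_const E n \<zeta>"
  unfolding lebesgue_const_def by (intro cSUP_upper bdd_above_lebesgue)

lemma lebesgue_const_ge_1:
  assumes "compact E" "E \<noteq> {}" "inj_on \<zeta> {0..n}" shows "lebesgue_const E n \<zeta> \<ge> 1"
proof -
  obtain z where z: "z \<in> E" using assms(2) by blast
  have "1 = norm (\<Sum>k=0..n. lagrange_fund n \<zeta> k z)" by (simp add: sum_lagrange_fund[OF assms(3)])
  also have "\<dots> \<le> (\<Sum>k=0..n. norm (lagrange_fund n \<zeta> k z))" by (rule norm_sum)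
  also have "\<dots> \<le> lebesgue_const E n \<zeta>" using assms z by (intro sum_lagrange_le_lebesgue_const)
  finally show ?thesis .
qed

section \<open>Comparison of the node potential with the Green function\<close>

locale green_nodes = green +
  fixes n :: nat and \<zeta> :: "nat \<Rightarrow> complex"
  assumes inj: "inj_on \<zeta> {0..n}" and nodes: "j \<le> n \<Longrightarrow> \<zeta> j \<in> E"
begin

abbreviation "gap \<equiv> node_gap n \<zeta>"
abbreviation "pot \<equiv> node_potential n \<zeta>"
abbreviation "\<Lambda> \<equiv> lebesgue_const E n \<zeta>"

lemma gap_pos: "gap > 0"
  using inj by (rule node_gap_pos)

lemma harmonic_pot: "harmonic_on pot (- E)"
proof -
  have "harmonic_on (\<lambda>z. 1 / (n + 1) * (\<Sum>j=0..n. ln (norm (z - \<zeta> j)))) (- E)"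
    using nodes by (intro harmonic_on_cmult harmonic_on_sum harmonic_on_ln_norm_diff open_compl) auto
  then show ?thesis by (simp add: node_potential_def[abs_def])
qed

lemma pot_minus_g_tendsto: "((\<lambda>z. pot z - g z) \<longlongrightarrow> - \<gamma>) at_infinity"
proof -
  have "((\<lambda>z. (\<Sum>j=0..n. ln (norm (z - \<zeta> j)) - ln (norm z)) / (n + 1) - (g z - ln (norm z)))
      \<longlongrightarrow> (\<Sum>j=0..n. 0) / (n + 1) - \<gamma>) at_infinity"
    by (intro tendsto_diff tendsto_divide tendsto_sum ln_norm_diff_tendsto g_minus_ln tendsto_const) auto
  moreover have "(\<lambda>z. (\<Sum>j=0..n. ln (norm (z - \<zeta> j)) - ln (norm z)) / (n + 1) - (g z - ln (norm z)))
      = (\<lambda>z. pot z - g z)"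
    by (simp add: node_potential_def sum_subtractf field_simps)
  ultimately show ?thesis by (simp only: sum.neutral_const div_0 diff_0)
qed

text \<open>
  Off the nodes, \<open>L\<^sub>k(z) = \<omega>(z) / ((z - \<zeta>\<^sub>k) \<omega>'(\<zeta>\<^sub>k))\<close>.
\<close>

lemma norm_lagrange_le:
  assumes z: "z \<notin> E" and k: "k \<le> n"
  shows "norm (lagrange_fund n \<zeta> k z) \<le> exp ((n + 1) * pot z) / (infdist z E * gap)"
proof -
  have nz: "z - \<zeta> j \<noteq> 0" if "j \<le> n" for j using z nodes[OF that] by auto
  have "exp ((n + 1) * pot z) = (\<Prod>j=0..n. norm (z - \<zeta> j))"
    using nz by (simp add: node_potential_def exp_sum)
  also have "\<dots> = norm (z - \<zeta> k) * (\<Prod>j\<in>{0..n} - {k}. norm (z - \<zeta> j))"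
    using k by (intro prod.remove) auto
  finally have e: "(\<Prod>j\<in>{0..n} - {k}. norm (z - \<zeta> j)) = exp ((n + 1) * pot z) / norm (z - \<zeta> k)"
    using nz[OF k] by (simp add: field_simps)
  have "infdist z E \<le> norm (z - \<zeta> k)" using infdist_le[OF nodes[OF k], of z] by (simp add: dist_norm)
  then have "infdist z E * gap \<le> norm (z - \<zeta> k) * norm (\<Prod>j\<in>{0..n} - {k}. \<zeta> j - \<zeta> k)"
    using node_gap_le[OF k] gap_pos infdist_nonneg by (intro mult_mono) auto
  moreover have "infdist z E * gap > 0" using z infdist_pos_iff gap_pos by simp
  ultimately have "exp ((n + 1) * pot z) / (norm (z - \<zeta> k) * norm (\<Prod>j\<in>{0..n} - {k}. \<zeta> j - \<zeta> k))
      \<le> exp ((n + 1) * pot z) / (infdist z E * gap)"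
    by (intro divide_left_mono) (auto intro!: mult_pos_pos)
  then show ?thesis unfolding norm_lagrange_fund e by (simp add: divide_divide_eq_left)
qed

text \<open>
  The Lagrange polynomials sum to \<open>1\<close>, so they cannot all be small at \<open>z\<close>. Hence \<open>\<bar>\<omega>(z)\<bar>\<close>
  is not much smaller than the gap of the nodes.
\<close>

lemma pot_lower:
  assumes z: "z \<notin> E"
  shows "pot z \<ge> (ln gap + ln (infdist z E) - ln (n + 1)) / (n + 1)"
proof -
  have pos: "infdist z E * gap > 0" using z infdist_pos_iff gap_pos by simp
  have "1 = norm (\<Sum>k=0..n. lagrange_fund n \<zeta> k z)" by (simp add: sum_lagrange_fund[OF inj])
  also have "\<dots> \<le> (\<Sum>k=0..n. norm (lagrange_fund n \<zeta> k z))" by (rule norm_sum)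
  also have "\<dots> \<le> (\<Sum>k=0..n. exp ((n + 1) * pot z) / (infdist z E * gap))"
    by (intro sum_mono norm_lagrange_le z) auto
  also have "\<dots> = (n + 1) * exp ((n + 1) * pot z) / (infdist z E * gap)" by simp
  finally have "infdist z E * gap \<le> (n + 1) * exp ((n + 1) * pot z)" using pos by (simp add: field_simps)
  then have "ln (infdist z E * gap) \<le> ln ((n + 1) * exp ((n + 1) * pot z))"
    using pos by (subst ln_le_cancel_iff) (auto intro: less_le_trans)
  also have "\<dots> = ln (n + 1) + (n + 1) * pot z" by (subst ln_mult) auto
  finally have "ln gap + ln (infdist z E) - ln (n + 1) \<le> (n + 1) * pot z"
    using z infdist_pos_iff[of z] gap_pos by (simp add: ln_mult)
  then show ?thesis by (simp add: divide_le_eq mult.commute)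
qed

text \<open>
  The second part is the heart of the upper estimate for the gap: it plays the role of the
  inequality between transfinite diameter and capacity. The function \<open>pot - g\<close> is bounded below near
  \<open>E\<close> by \<open>pot_lower\<close>, and the minimum principle carries the bound to infinity.
\<close>

lemma pot_minus_g_lower:
  assumes \<eta>: "\<eta> > 0" and small: "\<And>z. infdist z E = \<eta> \<Longrightarrow> g z \<le> \<epsilon>"
  shows "\<And>z. infdist z E \<ge> \<eta> \<Longrightarrow> pot z - g z \<ge> (ln gap + ln \<eta> - ln (n + 1)) / (n + 1) - \<epsilon>"
    and "- \<gamma> \<ge> (ln gap + ln \<eta> - ln (n + 1)) / (n + 1) - \<epsilon>"
proof -
  have h: "harmonic_on (\<lambda>z. pot z - g z) (- E)"
    by (intro harmonic_on_diff harmonic_pot harmonic_g)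
  have bd: "pot z - g z \<ge> (ln gap + ln \<eta> - ln (n + 1)) / (n + 1) - \<epsilon>" if "infdist z E = \<eta>" for z
  proof -
    have "z \<notin> E" using that \<eta> infdist_pos_iff[of z] by simp
    from pot_lower[OF this] small[OF that] that show ?thesis by simp
  qed
  show "\<And>z. infdist z E \<ge> \<eta> \<Longrightarrow> pot z - g z \<ge> (ln gap + ln \<eta> - ln (n + 1)) / (n + 1) - \<epsilon>"
    and "- \<gamma> \<ge> (ln gap + ln \<eta> - ln (n + 1)) / (n + 1) - \<epsilon>"
    using exterior_lower_bound[OF h pot_minus_g_tendsto \<eta> bd] by blast+
qed

text \<open>
  The Bernstein-Walsh inequality for the leading coefficient of the Lagrange polynomial whose
  denominator is the gap. All its zeros are nodes and lie in \<open>E\<close>, so \<open>g - ln \<bar>L\<^sub>k\<bar> / n\<close> is harmonic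
  outside of \<open>E\<close>, and its value at infinity is bounded below by its values near \<open>E\<close>.
\<close>

lemma power_capacity_le:
  assumes n: "n \<ge> 1" shows "exp (- \<gamma>) ^ n \<le> \<Lambda> * gap"
proof -
  obtain k where k: "k \<le> n" and gap: "gap = norm (\<Prod>j\<in>{0..n} - {k}. \<zeta> j - \<zeta> k)"
    by (rule node_gap_attained)
  define h where "h = (\<lambda>z. g z - 1 / n * (\<Sum>j\<in>{0..n} - {k}. ln (norm (z - \<zeta> j))))"
  have harm: "harmonic_on h (- E)"
    unfolding h_def using nodes
    by (intro harmonic_on_diff harmonic_on_cmult harmonic_on_sum harmonic_on_ln_norm_diff open_compl harmonic_g)
      auto
  have lim: "(h \<longlongrightarrow> \<gamma>) at_infinity"
  proof -
    have "((\<lambda>z. (g z - ln (norm z)) - 1 / n * (\<Sum>j\<in>{0..n} - {k}. ln (norm (z - \<zeta> j)) - ln (norm z)))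
       \<longlongrightarrow> \<gamma> - 1 / n * (\<Sum>j\<in>{0..n} - {k}. 0)) at_infinity"
      by (intro tendsto_diff tendsto_mult tendsto_sum ln_norm_diff_tendsto g_minus_ln tendsto_const)
    moreover have "(g z - ln (norm z)) - 1 / n * (\<Sum>j\<in>{0..n} - {k}. ln (norm (z - \<zeta> j)) - ln (norm z)) = h z"
      for z using n k by (simp add: h_def sum_subtractf field_simps)
    ultimately show ?thesis by simp
  qed
  have \<Lambda>1: "\<Lambda> \<ge> 1" by (rule lebesgue_const_ge_1[OF compact_E E_ne inj])
  \<comment> \<open>The bound \<open>\<Lambda>\<close> holds on \<open>E\<close> itself; by continuity \<open>\<Lambda> + \<epsilon>\<close> is a bound on a neighbourhood.\<close>
  have "exp (- \<gamma>) ^ n \<le> (\<Lambda> + \<epsilon>) * gap" if \<epsilon>: "\<epsilon> > 0" for \<epsilon>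
  proof -
    have "open {z. norm (lagrange_fund n \<zeta> k z) < \<Lambda> + \<epsilon>}"
      unfolding lagrange_fund_def divide_inverse by (intro open_Collect_less continuous_intros)
    moreover have "E \<subseteq> {z. norm (lagrange_fund n \<zeta> k z) < \<Lambda> + \<epsilon>}"
    proof safe
      fix z assume "z \<in> E"
      have "norm (lagrange_fund n \<zeta> k z) \<le> (\<Sum>j=0..n. norm (lagrange_fund n \<zeta> j z))"
        using k by (intro member_le_sum) auto
      also have "\<dots> \<le> \<Lambda>" by (rule sum_lagrange_le_lebesgue_const[OF compact_E \<open>z \<in> E\<close>])
      finally show "norm (lagrange_fund n \<zeta> k z) < \<Lambda> + \<epsilon>" using \<epsilon> by simp
    qed
    ultimately obtain \<eta> where \<eta>: "\<eta> > 0" "\<And>z. infdist z E \<le> \<eta> \<Longrightarrow> norm (lagrange_fund n \<zeta> k z) < \<Lambda> + \<epsilon>"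
      using compact_infdist_neighbourhood[OF compact_E E_ne] by (metis mem_Collect_eq)
    have pos: "(\<Lambda> + \<epsilon>) * gap > 0" using \<Lambda>1 \<epsilon> gap_pos by simp
    have "- (1 / n * ln ((\<Lambda> + \<epsilon>) * gap)) \<le> \<gamma>"
    proof (rule exterior_lower_bound(2)[OF harm lim \<eta>(1)])
      fix z assume z: "infdist z E = \<eta>"
      then have zE: "z \<notin> E" using \<eta>(1) infdist_pos_iff[of z] by simp
      then have nz: "norm (z - \<zeta> j) > 0" if "j \<le> n" for j using nodes[OF that] by auto
      have "(\<Prod>j\<in>{0..n} - {k}. norm (z - \<zeta> j)) = norm (lagrange_fund n \<zeta> k z) * gap"
        using gap_pos unfolding norm_lagrange_fund gap by simp
      also have "\<dots> \<le> (\<Lambda> + \<epsilon>) * gap" using \<eta>(2)[of z] z gap_pos by (intro mult_right_mono) auto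
      finally have "ln (\<Prod>j\<in>{0..n} - {k}. norm (z - \<zeta> j)) \<le> ln ((\<Lambda> + \<epsilon>) * gap)"
        using nz pos by (subst ln_le_cancel_iff) (auto intro!: prod_pos)
      moreover have "ln (\<Prod>j\<in>{0..n} - {k}. norm (z - \<zeta> j)) = (\<Sum>j\<in>{0..n} - {k}. ln (norm (z - \<zeta> j)))"
        using nz by (intro ln_prod) force+
      ultimately have "1 / n * (\<Sum>j\<in>{0..n} - {k}. ln (norm (z - \<zeta> j))) \<le> 1 / n * ln ((\<Lambda> + \<epsilon>) * gap)"
        by (intro mult_left_mono) auto
      then show "- (1 / n * ln ((\<Lambda> + \<epsilon>) * gap)) \<le> h z"
        using g_pos[OF zE] by (simp add: h_def)
    qed
    then have "n * (- \<gamma>) \<le> ln ((\<Lambda> + \<epsilon>) * gap)" using n by (simp add: field_simps)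
    then have "exp (n * (- \<gamma>)) \<le> (\<Lambda> + \<epsilon>) * gap" using pos by (simp add: ln_ge_iff)
    then show ?thesis unfolding exp_of_nat_mult .
  qed
  from this[of "e / gap" for e] have "exp (- \<gamma>) ^ n \<le> \<Lambda> * gap + e" if "e > 0" for e
    using that gap_pos by (simp add: algebra_simps)
  then show ?thesis by (rule field_le_epsilon)
qed

text \<open>
  The Lagrange polynomials are estimated on the level set at distance \<open>\<eta>\<close>, where the factor
  \<open>z - \<zeta>\<^sub>k\<close> is at least \<open>\<eta>\<close>, and the maximum modulus principle transfers the estimate to \<open>E\<close>.
\<close>

lemma lebesgue_const_upper:
  fixes b :: real
  assumes \<eta>: "\<eta> > 0" and small: "\<And>z. infdist z E = \<eta> \<Longrightarrow> pot z \<le> b"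
  shows "\<Lambda> \<le> (n + 1) * exp ((n + 1) * b) / (\<eta> * gap)"
  unfolding lebesgue_const_def
proof (rule cSUP_least[OF E_ne])
  let ?B = "{z. infdist z E < \<eta>}"
  let ?c = "exp ((n + 1) * b) / (\<eta> * gap)"
  have op: "open ?B" by (intro open_Collect_less continuous_intros)
  have "closure ?B \<subseteq> {z. infdist z E \<le> \<eta>}"
    by (rule closure_minimal) (auto intro!: closed_Collect_le continuous_intros)
  then have fr: "frontier ?B \<subseteq> {z. infdist z E = \<eta>}"
    using op by (auto simp: frontier_def interior_open)
  have "bounded {z. infdist z E \<le> \<eta>}"
    using compact_infdist_le[OF E_ne compact_E \<eta>] compact_imp_bounded by blast
  then have bB: "bounded ?B" by (rule bounded_subset) auto
  fix z assume "z \<in> E"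
  have "norm (lagrange_fund n \<zeta> k z) \<le> ?c" if k: "k \<le> n" for k
  proof (rule maximum_modulus_frontier[where f = "lagrange_fund n \<zeta> k", OF _ _ bB])
    show "lagrange_fund n \<zeta> k holomorphic_on interior ?B"
      unfolding lagrange_fund_def[abs_def] divide_inverse by (intro holomorphic_intros)
    show "continuous_on (closure ?B) (lagrange_fund n \<zeta> k)"
      unfolding lagrange_fund_def[abs_def] divide_inverse by (intro continuous_intros)
    show "z \<in> ?B" using \<open>z \<in> E\<close> \<eta> by simp
    fix w assume "w \<in> frontier ?B"
    then have w: "infdist w E = \<eta>" using fr by blast
    then have "w \<notin> E" using \<eta> infdist_pos_iff[of w] by simp
    from norm_lagrange_le[OF this k]
    have "norm (lagrange_fund n \<zeta> k w) \<le> exp ((n + 1) * pot w) / (\<eta> * gap)" by (simp add: w)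
    also have "\<dots> \<le> ?c" using mult_left_mono[OF small[OF w], of "n + 1"] \<eta> gap_pos by (intro divide_right_mono) auto
    finally show "norm (lagrange_fund n \<zeta> k w) \<le> ?c" .
  qed
  then have "(\<Sum>k=0..n. norm (lagrange_fund n \<zeta> k z)) \<le> (\<Sum>k=0..n. ?c)" by (intro sum_mono) auto
  then show "(\<Sum>k=0..n. norm (lagrange_fund n \<zeta> k z)) \<le> (n + 1) * exp ((n + 1) * b) / (\<eta> * gap)" by simp
qed

end

section \<open>Asymptotics of gaps and Lebesgue constants\<close>

lemma root_eq_exp_ln: "n > 0 \<Longrightarrow> x > 0 \<Longrightarrow> root n x = exp (ln x / n)"
  by (simp add: root_powr_inverse powr_def)

lemma linear_plus_ln_over_n_tendsto:
  fixes c d :: real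
  shows "(\<lambda>n. (real (n + 1) * c + ln (real (n + 1)) - d) / real n) \<longlonglongrightarrow> c"
  by real_asymp

locale green_node_sequence = green +
  fixes \<zeta> :: "nat \<Rightarrow> nat \<Rightarrow> complex"
  assumes seq_inj: "n \<ge> 1 \<Longrightarrow> inj_on (\<zeta> n) {0..n}"
    and seq_nodes: "n \<ge> 1 \<Longrightarrow> j \<le> n \<Longrightarrow> \<zeta> n j \<in> E"
begin

lemma nodes_at: "n \<ge> 1 \<Longrightarrow> green_nodes E g \<gamma> n (\<zeta> n)"
  using green_axioms seq_inj seq_nodes by (auto simp: green_nodes_def green_nodes_axioms_def)

text \<open>
  This half of the asymptotics holds for every choice of nodes: the gap is asymptotically never
  larger than the capacity to the power \<open>n\<close>.
\<close>

lemma eventually_ln_gap_le: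
  assumes \<epsilon>: "\<epsilon> > 0"
  shows "\<forall>\<^sub>F n in sequentially. ln (node_gap n (\<zeta> n)) / n \<le> - \<gamma> + \<epsilon>"
proof -
  obtain \<eta> where \<eta>: "\<eta> > 0" "\<And>z. z \<notin> E \<Longrightarrow> infdist z E \<le> \<eta> \<Longrightarrow> g z < \<epsilon> / 2"
    using g_small_near[of "\<epsilon> / 2"] \<epsilon> by auto
  have small: "g z \<le> \<epsilon> / 2" if "infdist z E = \<eta>" for z
    using \<eta>(2)[of z] infdist_pos_iff[of z] \<eta>(1) that by simp
  have bound: "ln (node_gap n (\<zeta> n)) / n \<le> (real (n + 1) * (\<epsilon> / 2 - \<gamma>) + ln (real (n + 1)) - ln \<eta>) / n"
    if n: "n \<ge> 1" for n :: nat
  proof -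
    interpret N: green_nodes E g \<gamma> n "\<zeta> n" using n by (rule nodes_at)
    have "(ln N.gap + ln \<eta> - ln (real (n + 1))) / real (n + 1) \<le> \<epsilon> / 2 - \<gamma>"
      using N.pot_minus_g_lower(2)[OF \<eta>(1) small] by simp
    then have "ln N.gap \<le> real (n + 1) * (\<epsilon> / 2 - \<gamma>) + ln (real (n + 1)) - ln \<eta>"
      by (simp add: divide_le_eq mult.commute)
    then show ?thesis by (rule divide_right_mono) simp
  qed
  have "(\<lambda>n. (real (n + 1) * (\<epsilon> / 2 - \<gamma>) + ln (real (n + 1)) - ln \<eta>) / n) \<longlonglongrightarrow> \<epsilon> / 2 - \<gamma>"
    by (rule linear_plus_ln_over_n_tendsto)
  then have "\<forall>\<^sub>F n in sequentially. (real (n + 1) * (\<epsilon> / 2 - \<gamma>) + ln (real (n + 1)) - ln \<eta>) / n < \<epsilon> - \<gamma>"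
    by (rule order_tendstoD) (use \<epsilon> in simp)
  then show ?thesis using eventually_ge_at_top[of 1]
  proof eventually_elim
    case (elim n)
    then show ?case using bound[of n] by linarith
  qed
qed

text \<open>
  If the gaps are asymptotically extremal, then for large \<open>n\<close> the function \<open>v = pot - g + \<gamma>\<close> has a
  lower bound close to \<open>0\<close> on compact sets, while it vanishes at infinity. Harnack's inequality turns
  this into an upper bound \<open>e\<close> on the level set at distance \<open>\<eta>\<close>, where also \<open>g < e\<close>. There \<open>\<bar>\<omega>\<bar>\<close> is at
  most \<open>exp ((n + 1) (2e - \<gamma>))\<close>, which exceeds the gap by a factor of growth rate about \<open>2e\<close>.
\<close>

lemma eventually_ln_lebesgue_le:
  assumes conn: "connected (- E)"
    and gaps: "(\<lambda>n. ln (node_gap n (\<zeta> n)) / n) \<longlonglongrightarrow> - \<gamma>" and \<epsilon>: "\<epsilon> > 0"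
  shows "\<forall>\<^sub>F n in sequentially. ln (lebesgue_const E n (\<zeta> n)) / n \<le> \<epsilon>"
proof -
  define e where "e = \<epsilon> / 3"
  have e: "e > 0" using \<epsilon> by (simp add: e_def)
  obtain \<eta> where \<eta>: "\<eta> > 0" "\<And>z. z \<notin> E \<Longrightarrow> infdist z E \<le> \<eta> \<Longrightarrow> g z < e"
    using g_small_near[OF e] by blast
  define K where "K = {z. infdist z E = \<eta>}"
  have "K = {z. infdist z E \<le> \<eta>} \<inter> {z. infdist z E = \<eta>}" by (auto simp: K_def)
  also have "compact \<dots>"
    using compact_infdist_le[OF E_ne compact_E \<eta>(1)]
    by (rule compact_Int_closed) (intro closed_Collect_eq continuous_intros)
  finally have K: "compact K" .
  have KE: "K \<subseteq> - E" using \<eta>(1) infdist_pos_iff by (auto simp: K_def)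
  obtain C L where C: "C > 0" and L: "compact L" "L \<subseteq> - E" and
    har: "\<And>v s x. harmonic_on v (- E) \<Longrightarrow> (v \<longlongrightarrow> 0) at_infinity \<Longrightarrow> s \<ge> 0 \<Longrightarrow>
       (\<And>w. w \<in> L \<Longrightarrow> v w \<ge> - s) \<Longrightarrow> x \<in> K \<Longrightarrow> v x \<le> C * s"
    using harnack_vanishing_at_infinity[OF conn K KE] by blast
  \<comment> \<open>A lower bound \<open>- s\<close> for \<open>v\<close> on \<open>L\<close> yields the upper bound \<open>C * s = e\<close> on \<open>K\<close>. The level \<open>\<delta>\<close>
    at which the lower bound is produced must be small enough for \<open>g \<le> s / 2\<close>, and it must leave \<open>L\<close>
    outside.\<close>
  define s where "s = e / C"
  have s: "s > 0" using e C by (simp add: s_def)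
  obtain \<eta>1 where \<eta>1: "\<eta>1 > 0" "\<And>z. z \<notin> E \<Longrightarrow> infdist z E \<le> \<eta>1 \<Longrightarrow> g z < s / 2"
    using g_small_near[of "s / 2"] s by auto
  obtain \<eta>2 where \<eta>2: "\<eta>2 > 0" "\<And>z. z \<in> L \<Longrightarrow> infdist z E \<ge> \<eta>2"
  proof (cases "L = {}")
    case False
    have "continuous_on L (\<lambda>z. infdist z E)" by (intro continuous_intros)
    from continuous_attains_inf[OF L(1) False this]
    obtain x where "x \<in> L" "\<And>y. y \<in> L \<Longrightarrow> infdist x E \<le> infdist y E" by blast
    then show ?thesis using that[of "infdist x E"] L(2) infdist_pos_iff by auto
  qed (use that[of 1] in auto)
  define \<delta> where "\<delta> = min \<eta>1 \<eta>2"
  have \<delta>: "\<delta> > 0" using \<eta>1(1) \<eta>2(1) by (simp add: \<delta>_def)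
  have small: "g z \<le> s / 2" if "infdist z E = \<delta>" for z
    using \<eta>1(2)[of z] infdist_pos_iff[of z] \<delta> that by (auto simp: \<delta>_def)
  have "(\<lambda>n. ln (node_gap n (\<zeta> n)) / n * (n / real (n + 1)) + (ln \<delta> - ln (real (n + 1))) / real (n + 1)) \<longlonglongrightarrow> - \<gamma> * 1 + 0"
    by (intro tendsto_add tendsto_mult gaps) real_asymp+
  then have "(\<lambda>n. ln (node_gap n (\<zeta> n)) / n * (n / real (n + 1)) + (ln \<delta> - ln (real (n + 1))) / real (n + 1)) \<longlonglongrightarrow> - \<gamma>" by simp
  then have ev1: "\<forall>\<^sub>F n in sequentially.
     ln (node_gap n (\<zeta> n)) / n * (n / real (n + 1)) + (ln \<delta> - ln (real (n + 1))) / real (n + 1) > - \<gamma> - s / 2"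
    using s by (intro order_tendstoD) auto
  have "(\<lambda>n. (real (n + 1) * (2 * e - \<gamma>) + ln (real (n + 1)) - ln \<eta>) / n - ln (node_gap n (\<zeta> n)) / n)
     \<longlonglongrightarrow> (2 * e - \<gamma>) - - \<gamma>"
    by (intro tendsto_diff gaps linear_plus_ln_over_n_tendsto)
  then have ev2: "\<forall>\<^sub>F n in sequentially.
     (real (n + 1) * (2 * e - \<gamma>) + ln (real (n + 1)) - ln \<eta>) / n - ln (node_gap n (\<zeta> n)) / n < 3 * e"
    using e by (intro order_tendstoD) auto
  show ?thesis using ev1 ev2 eventually_ge_at_top[of 1]
  proof eventually_elim
    case (elim n)
    interpret N: green_nodes E g \<gamma> n "\<zeta> n" using elim(3) by (rule nodes_at)
    define v where "v = (\<lambda>z. N.pot z - g z + \<gamma>)"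
    have "ln N.gap / n * (n / real (n + 1)) = ln N.gap / real (n + 1)" using elim(3) by simp
    then have low: "(ln N.gap + ln \<delta> - ln (real (n + 1))) / real (n + 1) > - \<gamma> - s / 2"
      using elim(1) by (simp add: add_divide_distrib diff_divide_distrib)
    have "v z \<le> C * s" if "z \<in> K" for z
    proof (rule har[OF _ _ _ _ that])
      show "harmonic_on v (- E)" unfolding v_def
        by (intro harmonic_on_add harmonic_on_diff N.harmonic_pot harmonic_g harmonic_on_const open_compl)
      show "(v \<longlongrightarrow> 0) at_infinity"
        unfolding v_def using tendsto_add[OF N.pot_minus_g_tendsto tendsto_const[of \<gamma>]] by simp
      show "v w \<ge> - s" if "w \<in> L" for w
      proof -
        have "infdist w E \<ge> \<delta>" using \<eta>2(2)[OF that] by (simp add: \<delta>_def)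
        from N.pot_minus_g_lower(1)[OF \<delta> small this] low show ?thesis by (simp add: v_def)
      qed
    qed (use s in simp)
    moreover have "C * s = e" using C by (simp add: s_def)
    ultimately have "N.pot z \<le> 2 * e - \<gamma>" if "infdist z E = \<eta>" for z
      using \<eta> infdist_pos_iff[of z] that by (fastforce simp: v_def K_def)
    from N.lebesgue_const_upper[OF \<eta>(1) this]
    have up: "N.\<Lambda> \<le> real (n + 1) * exp (real (n + 1) * (2 * e - \<gamma>)) / (\<eta> * N.gap)" .
    have "N.\<Lambda> > 0" using lebesgue_const_ge_1[OF compact_E E_ne N.inj] by simp
    then have "ln N.\<Lambda> \<le> ln (real (n + 1) * exp (real (n + 1) * (2 * e - \<gamma>)) / (\<eta> * N.gap))"
      using up by (subst ln_le_cancel_iff) (auto intro: less_le_trans)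
    also have "\<dots> = ln (real (n + 1)) + real (n + 1) * (2 * e - \<gamma>) - (ln \<eta> + ln N.gap)"
      using \<eta>(1) N.gap_pos by (subst ln_div; (subst ln_mult)?) (auto simp: ln_mult)
    finally have "ln N.\<Lambda> / n \<le> (ln (real (n + 1)) + real (n + 1) * (2 * e - \<gamma>) - (ln \<eta> + ln N.gap)) / n"
      by (rule divide_right_mono) simp
    also have "\<dots> = (real (n + 1) * (2 * e - \<gamma>) + ln (real (n + 1)) - ln \<eta>) / n - ln N.gap / n"
      by (simp add: diff_divide_distrib add_divide_distrib)
    finally show ?case using elim(2) by (simp add: e_def)
  qed
qed

text \<open>
  Towards the gaps, the lower bound is \<open>exp (- \<gamma>) ^ n \<le> \<Lambda> * gap\<close> and the upper bound holds for any
  nodes. Towards the Lebesgue constants, the lower bound is \<open>\<Lambda> \<ge> 1\<close> and the upper bound is the one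
  from Harnack's inequality.
\<close>

lemma root_lebesgue_tendsto_iff:
  assumes conn: "connected (- E)"
  shows "(\<lambda>n. root n (lebesgue_const E n (\<zeta> n))) \<longlonglongrightarrow> 1 \<longleftrightarrow>
         (\<lambda>n. root n (node_gap n (\<zeta> n))) \<longlonglongrightarrow> exp (- \<gamma>)"
proof
  assume lim: "(\<lambda>n. root n (lebesgue_const E n (\<zeta> n))) \<longlonglongrightarrow> 1"
  show "(\<lambda>n. root n (node_gap n (\<zeta> n))) \<longlonglongrightarrow> exp (- \<gamma>)"
  proof (rule order_tendstoI)
    fix a assume a: "a < exp (- \<gamma>)"
    have "(\<lambda>n. exp (- \<gamma>) / root n (lebesgue_const E n (\<zeta> n))) \<longlonglongrightarrow> exp (- \<gamma>) / 1"
      by (intro tendsto_divide tendsto_const lim) simp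
    then have "\<forall>\<^sub>F n in sequentially. exp (- \<gamma>) / root n (lebesgue_const E n (\<zeta> n)) > a"
      using a by (intro order_tendstoD) auto
    then show "\<forall>\<^sub>F n in sequentially. a < root n (node_gap n (\<zeta> n))"
      using eventually_ge_at_top[of 1]
    proof eventually_elim
      case (elim n)
      interpret N: green_nodes E g \<gamma> n "\<zeta> n" using elim(2) by (rule nodes_at)
      have "N.\<Lambda> > 0" using lebesgue_const_ge_1[OF compact_E E_ne N.inj] by simp
      have "root n (exp (- \<gamma>) ^ n) \<le> root n (N.\<Lambda> * N.gap)"
        using elim(2) N.power_capacity_le[OF elim(2)] by (intro real_root_le_mono) auto
      then have "exp (- \<gamma>) \<le> root n N.\<Lambda> * root n N.gap"
        using elim(2) by (simp add: real_root_power_cancel real_root_mult)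
      then have "exp (- \<gamma>) / root n N.\<Lambda> \<le> root n N.gap"
        using elim(2) \<open>N.\<Lambda> > 0\<close> by (simp add: divide_le_eq mult.commute)
      then show ?case using elim(1) by simp
    qed
  next
    fix a assume a: "exp (- \<gamma>) < a"
    then have a0: "a > 0" using exp_gt_zero less_trans by blast
    then have "- \<gamma> < ln a" using a by (metis exp_less_cancel_iff exp_ln)
    define \<epsilon> where "\<epsilon> = (ln a + \<gamma>) / 2"
    have \<epsilon>: "\<epsilon> > 0" "- \<gamma> + \<epsilon> < ln a" using \<open>- \<gamma> < ln a\<close> by (auto simp: \<epsilon>_def field_simps)
    show "\<forall>\<^sub>F n in sequentially. root n (node_gap n (\<zeta> n)) < a"
      using eventually_ln_gap_le[OF \<epsilon>(1)] eventually_ge_at_top[of 1]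
    proof eventually_elim
      case (elim n)
      have "root n (node_gap n (\<zeta> n)) = exp (ln (node_gap n (\<zeta> n)) / n)"
        using elim(2) node_gap_pos[OF seq_inj[OF elim(2)]] by (intro root_eq_exp_ln) auto
      also have "\<dots> < exp (ln a)" using elim(1) \<epsilon>(2) by simp
      finally show ?case using a0 by simp
    qed
  qed
next
  assume "(\<lambda>n. root n (node_gap n (\<zeta> n))) \<longlonglongrightarrow> exp (- \<gamma>)"
  then have "(\<lambda>n. ln (root n (node_gap n (\<zeta> n)))) \<longlonglongrightarrow> ln (exp (- \<gamma>))"
    by (rule tendsto_ln) simp
  moreover have "\<forall>\<^sub>F n in sequentially. ln (root n (node_gap n (\<zeta> n))) = ln (node_gap n (\<zeta> n)) / n"
    using eventually_ge_at_top[of 1]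
  proof eventually_elim
    case (elim n)
    then show ?case using node_gap_pos[OF seq_inj[OF elim]] by (simp add: root_eq_exp_ln)
  qed
  ultimately have gaps: "(\<lambda>n. ln (node_gap n (\<zeta> n)) / n) \<longlonglongrightarrow> - \<gamma>"
    by (simp add: tendsto_cong)
  have \<Lambda>1: "lebesgue_const E n (\<zeta> n) \<ge> 1" if "n \<ge> 1" for n
    using lebesgue_const_ge_1[OF compact_E E_ne seq_inj[OF that]] .
  show "(\<lambda>n. root n (lebesgue_const E n (\<zeta> n))) \<longlonglongrightarrow> 1"
  proof (rule order_tendstoI)
    fix a :: real assume a: "a < 1"
    show "\<forall>\<^sub>F n in sequentially. a < root n (lebesgue_const E n (\<zeta> n))"
      using eventually_ge_at_top[of 1]
    proof eventually_elim
      case (elim n)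
      then have "root n (lebesgue_const E n (\<zeta> n)) \<ge> 1" using \<Lambda>1[OF elim] by simp
      then show ?case using a by simp
    qed
  next
    fix a :: real assume a: "1 < a"
    have "ln a / 2 > 0" using a by simp
    from eventually_ln_lebesgue_le[OF conn gaps this] eventually_ge_at_top[of 1]
    show "\<forall>\<^sub>F n in sequentially. root n (lebesgue_const E n (\<zeta> n)) < a"
    proof eventually_elim
      case (elim n)
      have "root n (lebesgue_const E n (\<zeta> n)) = exp (ln (lebesgue_const E n (\<zeta> n)) / n)"
        using elim(2) \<Lambda>1[OF elim(2)] by (intro root_eq_exp_ln) auto
      also have "\<dots> \<le> exp (ln a / 2)" using elim(1) by simp
      also have "\<dots> < exp (ln a)" using ln_gt_zero[OF a] unfolding exp_less_cancel_iff by simp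
      finally show ?case using a by simp
    qed
  qed
qed

end

lemma Min_root_eq_root_node_gap:
  assumes "n \<ge> 1"
  shows "(MIN k\<in>{0..n}. root n (norm (\<Prod>j\<in>{0..n} - {k}. \<zeta> j - \<zeta> k))) = root n (node_gap n \<zeta>)"
proof -
  have "mono (root n)" using assms by (intro monoI) simp
  from mono_Min_commute[OF this, of "(\<lambda>k. norm (\<Prod>j\<in>{0..n} - {k}. \<zeta> j - \<zeta> k)) ` {0..n}"]
  show ?thesis by (simp add: node_gap_def image_image)
qed

theorem theorem1p2:
  fixes E :: "complex set" and \<zeta> :: "nat \<Rightarrow> nat \<Rightarrow> complex"
  assumes "compact E"
    and "polynomially_convex E"
    and "regular_compact E"
    and "\<And>n. n \<ge> 1 \<Longrightarrow> inj_on (\<zeta> n) {0..n}"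
    and "\<And>n j. n \<ge> 1 \<Longrightarrow> j \<le> n \<Longrightarrow> \<zeta> n j \<in> E"
  shows "((\<lambda>n. root n (lebesgue_const E n (\<zeta> n))) \<longlonglongrightarrow> 1) \<longleftrightarrow>
         ((\<lambda>n. MIN k\<in>{0..n}. root n (norm (\<Prod>j\<in>{0..n} - {k}. \<zeta> n j - \<zeta> n k)))
            \<longlonglongrightarrow> log_capacity E)"
proof -
  obtain g \<gamma> where green: "green_function E g \<gamma>" using assms(3) by (auto simp: regular_compact_def)
  have ne: "E \<noteq> {}" using assms(5)[of 1 0] by auto
  have outer: "outer_domain E = - E"
    using assms(2) by (simp add: outer_domain_def polynomially_convex_def)
  interpret green_node_sequence E g \<gamma> \<zeta>
    by unfold_locales (use assms ne outer green in auto)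
  have "\<forall>\<^sub>F n in sequentially. (MIN k\<in>{0..n}. root n (norm (\<Prod>j\<in>{0..n} - {k}. \<zeta> n j - \<zeta> n k)))
      = root n (node_gap n (\<zeta> n))"
    using eventually_ge_at_top[of 1] by eventually_elim (rule Min_root_eq_root_node_gap)
  then have "((\<lambda>n. MIN k\<in>{0..n}. root n (norm (\<Prod>j\<in>{0..n} - {k}. \<zeta> n j - \<zeta> n k))) \<longlonglongrightarrow> log_capacity E)
    \<longleftrightarrow> (\<lambda>n. root n (node_gap n (\<zeta> n))) \<longlonglongrightarrow> exp (- \<gamma>)"
    unfolding log_capacity_eq by (rule tendsto_cong)
  then show ?thesis
    using root_lebesgue_tendsto_iff[OF connected_complement_polynomially_convex[OF assms(1) ne assms(2)]]
    by simp
qed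

end
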